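(* Let $n\ge 1$ and let $P\subseteq\mathbb R^n$ be a bounded convex set of positive volume. For any bounded convex set $Q\subseteq\mathbb R^n$ of positive volume, let $r_Q$ be the smallest degree of a nonzero polynomial in $\mathbb R[X_1,\dots,X_n]$ vanishing on $Q\cap\mathbb Z^n$, and let $s_Q$ be the smallest number $u\ge 0$ such that every function $Q\cap\mathbb Z^n\to\mathbb R$ can be interpolated by a polynomial in $\mathbb R[X_1,\dots,X_n]$ of degree at most $u$. Then there are real numbers $v_P,w_P>0$ such that, as the real number $d$ goes to infinity, $(r_{d\cdot P}-1)/d$ converges from below to $v_P$ and $s_{d\cdot P}/d$ converges from below to $w_P$. These numbers satisfy \[ v_P^{\,n-1}\,w_P\le n!\cdot\operatorname{vol}(P). \]
   Context: For a real number $d$ and $A\subseteq\mathbb R^n$, $d\cdot A=\{d\cdot a\mid a\in A\}$. "Degree" means total degree. $\operatorname{vol}$ is $n$-dimensional Lebesgue measure. A quantity depending on a real number $d>0$ "converges from below" to a limit if it converges to that limit as $d\to\infty$ and is less than or equal to the limit for all $d>0$. *)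

theory Defs
  imports "HOL-Analysis.Analysis" "HOL-Library.Poly_Mapping"
begin

text \<open>
  A polynomial in the variables indexed by the finite type \<open>'n\<close> is a finitely supported map from
  exponent vectors to coefficients; the ring structure is the convolution product of
  \<open>Poly_Mapping\<close>.
\<close>

type_synonym 'n mpoly = "('n \<Rightarrow>\<^sub>0 nat) \<Rightarrow>\<^sub>0 real"

definition mpoly_eval :: "'n::finite mpoly \<Rightarrow> real ^ 'n \<Rightarrow> real" where
  "mpoly_eval p x =
     (\<Sum>m\<in>Poly_Mapping.keys p.
        Poly_Mapping.lookup p m * (\<Prod>i\<in>UNIV. (x $ i) ^ Poly_Mapping.lookup m i))"

text \<open>The zero polynomial is given total degree 0.\<close>

definition total_degree :: "'n::finite mpoly \<Rightarrow> nat" where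
  "total_degree p =
     Max (insert 0 ((\<lambda>m. \<Sum>i\<in>UNIV. Poly_Mapping.lookup m i) ` Poly_Mapping.keys p))"

definition integer_points :: "(real ^ 'n::finite) set" where
  "integer_points = {x. \<forall>i. x $ i \<in> \<int>}"

text \<open>
  For bounded \<open>Q\<close> there are only finitely many integer points in \<open>Q\<close>, so that the minima in the next
  two definitions are attained. Functions on these points are represented by their (arbitrary)
  extensions to the whole space.
\<close>

definition vanishing_degree :: "(real ^ 'n::finite) set \<Rightarrow> nat" where
  "vanishing_degree Q =
     (LEAST k. \<exists>p. p \<noteq> 0 \<and> total_degree p = k \<and>
        (\<forall>x\<in>Q \<inter> integer_points. mpoly_eval p x = 0))"

definition interpolation_degree :: "(real ^ 'n::finite) set \<Rightarrow> nat" where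
  "interpolation_degree Q =
     (LEAST u. \<forall>f :: real ^ 'n \<Rightarrow> real. \<exists>p. total_degree p \<le> u \<and>
        (\<forall>x\<in>Q \<inter> integer_points. mpoly_eval p x = f x))"

definition converges_from_below :: "(real \<Rightarrow> real) \<Rightarrow> real \<Rightarrow> bool" where
  "converges_from_below f L \<longleftrightarrow> (f \<longlongrightarrow> L) at_top \<and> (\<forall>d>0. f d \<le> L)"

end

theory Submission
  imports Defs "HOL-Computational_Algebra.Polynomial"
begin

text \<open>
  The dual of interpolation on a finite set \<open>A\<close> of integer points is the space of Laurent polynomials
  \<open>\<Sum> c a X^a\<close> with exponents in \<open>A\<close>: such a polynomial vanishes to order \<open>\<ge> k\<close> at \<open>(1,\<dots>,1)\<close> iff
  \<open>\<Sum> c a p(a) = 0\<close> for all polynomials \<open>p\<close> of degree \<open>< k\<close>. So the interpolation degree of \<open>A\<close> is the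
  largest order of vanishing of a nonzero Laurent polynomial supported on \<open>A\<close>, and the vanishing
  degree exceeds \<open>k\<close> iff every monomial of degree \<open>\<le> k\<close> is a leading form at \<open>(1,\<dots>,1)\<close>. Leading forms
  are multiplicative, and products are supported on sums of supports; since
  \<open>d P + e P \<subseteq> (d + e) P\<close> this makes both degrees (the vanishing degree after subtracting 1)
  superadditive in \<open>d\<close>, and Fekete's argument gives the limits. For the volume bound put \<open>r + 1\<close> and
  \<open>s\<close> for the two degrees of \<open>d P\<close> and let \<open>h\<close> be a leading form of degree \<open>s\<close>. On \<open>N d P\<close> all the
  forms \<open>h^i y^m\<close> with \<open>|m| \<le> (N - i) r\<close> are leading forms, and a degree by degree count of independent
  ones shows that \<open>N d P\<close> has at least about \<open>N^n r^(n - 1) s / n!\<close> integer points.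
\<close>

section \<open>Exponents, monomials and the multinomial expansion\<close>

type_synonym 'n exponent = "'n \<Rightarrow>\<^sub>0 nat"

definition exponent_degree :: "'n::finite exponent \<Rightarrow> nat" where
  "exponent_degree m = (\<Sum>i\<in>UNIV. Poly_Mapping.lookup m i)"

definition monomial_at :: "real ^ 'n \<Rightarrow> 'n::finite exponent \<Rightarrow> real" where
  "monomial_at x m = (\<Prod>i\<in>UNIV. (x $ i) ^ Poly_Mapping.lookup m i)"

definition exponents_of_degree :: "nat \<Rightarrow> 'n::finite exponent set" where
  "exponents_of_degree k = {m. exponent_degree m = k}"

definition exponents_upto :: "nat \<Rightarrow> 'n::finite exponent set" where
  "exponents_upto k = {m. exponent_degree m \<le> k}"

lemma exponent_degree_zero [simp]: "exponent_degree 0 = 0"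
  by (simp add: exponent_degree_def)

lemma exponent_degree_single [simp]: "exponent_degree (Poly_Mapping.single i k) = k"
  by (simp add: exponent_degree_def lookup_single when_def)

lemma exponent_degree_add: "exponent_degree (a + b) = exponent_degree a + exponent_degree b"
  by (simp add: exponent_degree_def lookup_add sum.distrib)

lemma exponent_degree_eq_0_iff [simp]: "exponent_degree m = 0 \<longleftrightarrow> m = 0"
  by (auto simp: exponent_degree_def intro!: poly_mapping_eqI)

lemma monomial_at_zero [simp]: "monomial_at x 0 = 1"
  by (simp add: monomial_at_def)

lemma monomial_at_single [simp]: "monomial_at x (Poly_Mapping.single i k) = (x $ i) ^ k"
proof -
  have "monomial_at x (Poly_Mapping.single i k) = (\<Prod>j\<in>UNIV. if j = i then (x $ i) ^ k else 1)"
    unfolding monomial_at_def by (intro prod.cong) (auto simp: lookup_single when_def)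
  then show ?thesis by simp
qed

lemma monomial_at_add: "monomial_at x (a + b) = monomial_at x a * monomial_at x b"
  by (simp add: monomial_at_def lookup_add power_add prod.distrib)

lemma monomial_at_mult:
  "monomial_at (\<chi> i. x $ i * y $ i) m = monomial_at x m * monomial_at y m"
  by (simp add: monomial_at_def power_mult_distrib prod.distrib)

lemma finite_exponents_upto [simp]: "finite (exponents_upto k :: 'n::finite exponent set)"
proof (rule finite_imageD)
  show "inj_on Poly_Mapping.lookup (exponents_upto k :: 'n exponent set)"
    by (rule inj_onI) (rule poly_mapping_eqI, simp)
  have le: "Poly_Mapping.lookup m i \<le> exponent_degree m" for m :: "'n exponent" and i
    unfolding exponent_degree_def by (rule member_le_sum) auto
  have "Poly_Mapping.lookup m i \<le> k" if "m \<in> exponents_upto k" for m :: "'n exponent" and i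
    using le[of m i] that by (simp add: exponents_upto_def)
  then have "Poly_Mapping.lookup ` (exponents_upto k :: 'n exponent set) \<subseteq> PiE UNIV (\<lambda>_. {..k})"
    by auto
  then show "finite (Poly_Mapping.lookup ` (exponents_upto k :: 'n exponent set))"
    by (rule finite_subset) (simp add: finite_PiE)
qed

lemma exponents_of_degree_subset: "j \<le> k \<Longrightarrow> exponents_of_degree j \<subseteq> exponents_upto k"
  by (auto simp: exponents_of_degree_def exponents_upto_def)

lemma finite_exponents_of_degree [simp]: "finite (exponents_of_degree k)"
  by (rule finite_subset[OF exponents_of_degree_subset[of k k]]) simp_all

text \<open>Unit vectors are moved from the remainder to the first part one at a time. Such
  splittings turn a monomial symbol on a sum of sets into a product of monomial symbols on the
  summands.\<close>

lemma exponent_split_degree: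
  assumes "k \<le> exponent_degree m"
  obtains a b where "m = a + b" "exponent_degree a = k"
  using assms
proof (induction k arbitrary: thesis)
  case 0
  then show ?case using "0.prems"(1)[of 0 m] by simp
next
  case (Suc k)
  have "k \<le> exponent_degree m" using Suc.prems(2) by simp
  then obtain a b where ab: "m = a + b" "exponent_degree a = k" using Suc.IH by blast
  with Suc.prems have "b \<noteq> 0" by (auto simp: exponent_degree_add)
  then obtain i where i: "Poly_Mapping.lookup b i > 0"
    by (metis gr0I lookup_zero poly_mapping_eqI)
  let ?e = "Poly_Mapping.single i (1::nat)"
  have "b = ?e + (b - ?e)"
    by (rule poly_mapping_eqI) (use i in \<open>auto simp: lookup_add lookup_minus lookup_single when_def\<close>)
  then have "m = (a + ?e) + (b - ?e)" using ab by (simp add: add.assoc)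
  moreover have "exponent_degree (a + ?e) = Suc k" using ab by (simp add: exponent_degree_add)
  ultimately show ?case by (rule Suc.prems(1))
qed

lemma exponent_split_degrees:
  assumes "exponent_degree m \<le> k + l"
  obtains a b where "m = a + b" "exponent_degree a \<le> k" "exponent_degree b \<le> l"
proof (cases "exponent_degree m \<le> k")
  case True
  then show ?thesis using that[of m 0] by simp
next
  case False
  then have "k \<le> exponent_degree m" by simp
  then obtain a b where ab: "m = a + b" "exponent_degree a = k"
    by (rule exponent_split_degree)
  then show ?thesis using that[of a b] assms by (simp add: exponent_degree_add)
qed

lemma exponent_degree_1E:
  assumes "exponent_degree b = 1"
  obtains i where "b = Poly_Mapping.single i 1"
proof -
  have "b \<noteq> 0" using assms by auto
  then obtain i where i: "Poly_Mapping.lookup b i > 0"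
    by (metis gr0I lookup_zero poly_mapping_eqI)
  let ?b = "b - Poly_Mapping.single i 1"
  have b: "b = Poly_Mapping.single i 1 + ?b"
    by (rule poly_mapping_eqI)
      (use i in \<open>auto simp: lookup_add lookup_minus lookup_single when_def\<close>)
  have "1 = 1 + exponent_degree ?b"
    using arg_cong[OF b, of exponent_degree] assms
    by (simp only: exponent_degree_add exponent_degree_single)
  then have "?b = 0" by simp
  with b have "b = Poly_Mapping.single i 1" by (simp only: add_0_right)
  then show ?thesis by (rule that)
qed

text \<open>Scaling one coordinate by 2 separates two given exponents, so the linear independence of
  characters applies.\<close>

lemma monomials_independent:
  fixes S :: "'n::finite exponent set"
  assumes "finite S" "\<And>y. (\<Sum>m\<in>S. c m * monomial_at y m) = 0" "m \<in> S"
  shows "c m = 0"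
  using assms
proof (induction S arbitrary: c m rule: finite_induct)
  case empty
  then show ?case by simp
next
  case (insert b S)
  have S0: "c a = 0" if "a \<in> S" for a
  proof -
    from that insert.hyps have "a \<noteq> b" by auto
    then obtain i where i: "Poly_Mapping.lookup a i \<noteq> Poly_Mapping.lookup b i"
      by (metis poly_mapping_eqI)
    define r :: "'n exponent \<Rightarrow> real" where "r m = 2 ^ Poly_Mapping.lookup m i" for m
    define z :: "real ^ 'n" where "z = (\<chi> j. if j = i then 2 else 1)"
    have r: "monomial_at z m = r m" for m
    proof -
      have "monomial_at z m = (\<Prod>j\<in>UNIV. if j = i then r m else 1)"
        unfolding monomial_at_def z_def r_def by (intro prod.cong) auto
      then show ?thesis by simp
    qed
    have "(\<Sum>m\<in>S. (c m * (r m - r b)) * monomial_at y m) = 0" for y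
    proof -
      \<comment> \<open>Evaluating the relation at the scaled point multiplies each term by
        \<open>r m\<close>; subtracting \<open>r b\<close> times the original relation removes the
        term of \<open>b\<close>.\<close>
      have "(\<Sum>m\<in>insert b S. c m * monomial_at (\<chi> j. z $ j * y $ j) m)
          - r b * (\<Sum>m\<in>insert b S. c m * monomial_at y m) = 0"
        using insert.prems(1) by simp
      then have "(\<Sum>m\<in>insert b S. (c m * (r m - r b)) * monomial_at y m) = 0"
        by (simp only: monomial_at_mult r sum_distrib_left flip: sum_subtractf)
           (simp add: algebra_simps)
      then show ?thesis using insert.hyps by simp
    qed
    then have "c a * (r a - r b) = 0" using insert.IH[of "\<lambda>m. c m * (r m - r b)" a] that by simp
    moreover have "r a \<noteq> r b" using i by (simp add: r_def)
    ultimately show ?thesis by simp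
  qed
  moreover have "c b = 0"
  proof -
    have "monomial_at 1 b = (1::real)" by (simp add: monomial_at_def)
    moreover have "(\<Sum>m\<in>S. c m * monomial_at 1 m) = 0" using S0 by (intro sum.neutral) auto
    ultimately show ?thesis using insert.prems(1)[of 1] insert.hyps by simp
  qed
  ultimately show ?case using insert.prems by auto
qed

text \<open>The multinomial theorem; positivity is all that is needed of the coefficients.\<close>

lemma multinomial_positive_coeffs:
  "\<exists>c. (\<forall>m\<in>exponents_of_degree k. c m > 0) \<and>
     (\<forall>x. (\<Sum>i\<in>UNIV. x $ i) ^ k =
        (\<Sum>m\<in>(exponents_of_degree k :: 'n::finite exponent set). c m * monomial_at x m))"
proof (induction k)
  case 0
  have "exponents_of_degree 0 = {0 :: 'n exponent}" by (auto simp: exponents_of_degree_def)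
  then show ?case by (intro exI[of _ "\<lambda>_. 1"]) simp
next
  case (Suc k)
  let ?E = "\<lambda>k. exponents_of_degree k :: 'n exponent set"
  obtain c where c: "\<forall>m\<in>?E k. c m > 0"
    "\<And>x. (\<Sum>i\<in>UNIV. x $ i) ^ k = (\<Sum>m\<in>?E k. c m * monomial_at x m)" using Suc.IH by blast
  let ?g = "\<lambda>(i, m). m + Poly_Mapping.single i (1::nat)"
  define T where "T = (UNIV :: 'n set) \<times> ?E k"
  \<comment> \<open>The new coefficient collects all ways to write \<open>m\<close> as an exponent
    of degree \<open>k\<close> plus a unit vector. There is at least one, so it stays
    positive.\<close>
  define c' where "c' m = (\<Sum>(i, a)\<in>{p \<in> T. ?g p = m}. c a)" for m
  have fin: "finite T" by (simp add: T_def)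
  have gT: "?g ` T \<subseteq> ?E (Suc k)"
    by (auto simp: T_def exponents_of_degree_def exponent_degree_add)
  have "c' m > 0" if "m \<in> ?E (Suc k)" for m
  proof -
    have "k \<le> exponent_degree m" using that by (simp add: exponents_of_degree_def)
    then obtain a b where ab: "m = a + b" "exponent_degree a = k"
      by (rule exponent_split_degree)
    then have "exponent_degree b = 1"
      using that by (simp add: exponents_of_degree_def exponent_degree_add)
    then obtain i where i: "b = Poly_Mapping.single i 1" by (rule exponent_degree_1E)
    have "(i, a) \<in> {p \<in> T. ?g p = m}" using ab i by (auto simp: T_def exponents_of_degree_def)
    then show ?thesis unfolding c'_def
      by (intro sum_pos finite_subset[OF _ fin]) (use c(1) in \<open>auto simp: T_def\<close>)
  qed
  moreover have "(\<Sum>i\<in>UNIV. x $ i) ^ Suc k = (\<Sum>m\<in>?E (Suc k). c' m * monomial_at x m)" for x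
  proof -
    have "(\<Sum>i\<in>UNIV. x $ i) ^ Suc k = (\<Sum>i\<in>UNIV. \<Sum>a\<in>?E k. x $ i * (c a * monomial_at x a))"
      by (simp only: power_Suc c(2) sum_distrib_left sum_distrib_right) (rule sum.swap)
    also have "\<dots> = (\<Sum>i\<in>UNIV. \<Sum>a\<in>?E k. c a * monomial_at x (?g (i, a)))"
      by (intro sum.cong refl) (simp add: monomial_at_add)
    also have "\<dots> = (\<Sum>(i, a)\<in>T. c a * monomial_at x (?g (i, a)))"
      unfolding T_def by (rule sum.cartesian_product)
    also have "\<dots> = (\<Sum>m\<in>?E (Suc k). \<Sum>p\<in>{p \<in> T. ?g p = m}. (\<lambda>(i, a). c a * monomial_at x (?g (i, a))) p)"
      by (rule sum.group[symmetric]) (use fin gT in auto)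
    also have "\<dots> = (\<Sum>m\<in>?E (Suc k). c' m * monomial_at x m)"
      unfolding c'_def sum_distrib_right by (rule sum.cong[OF refl], rule sum.cong[OF refl]) (simp split: prod.splits)
    finally show ?thesis .
  qed
  ultimately show ?case by blast
qed

text \<open>The multinomial theorem at the coordinatewise product of \<open>x\<close> and
  \<open>y\<close>. Powers of linear forms in \<open>y\<close> thereby encode the values of all
  monomials at \<open>x\<close>, and positive weights can be divided out.\<close>

lemma inner_power_expansion:
  obtains c where "\<And>m. m \<in> exponents_of_degree k \<Longrightarrow> c m > 0"
    "\<And>x y :: real ^ 'n::finite. (x \<bullet> y) ^ k =
       (\<Sum>m\<in>exponents_of_degree k. c m * (monomial_at x m * monomial_at y m))"
proof -
  obtain c where c: "\<forall>m\<in>exponents_of_degree k. c m > 0"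
    "\<And>x :: real ^ 'n. (\<Sum>i\<in>UNIV. x $ i) ^ k = (\<Sum>m\<in>exponents_of_degree k. c m * monomial_at x m)"
    using multinomial_positive_coeffs[of k] by blast
  have "(x \<bullet> y) ^ k = (\<Sum>m\<in>exponents_of_degree k. c m * (monomial_at x m * monomial_at y m))"
    for x y :: "real ^ 'n"
    using c(2)[of "\<chi> i. x $ i * y $ i"] by (simp add: inner_vec_def monomial_at_mult)
  with c(1) show ?thesis using that[of c] by blast
qed

subsection \<open>Finite linear systems\<close>

text \<open>A subspace of a finite-dimensional function space is either everything or lies in a
  hyperplane. The induction over points replaces dimension theory. It is applied twice, with the
  roles of points and exponents interchanged.\<close>

lemma interpolate_or_annihilate:
  fixes W :: "('a \<Rightarrow> real) set"
  assumes "finite A"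
    and add: "\<And>f g. f \<in> W \<Longrightarrow> g \<in> W \<Longrightarrow> (\<lambda>x. f x + g x) \<in> W"
    and scale: "\<And>f r. f \<in> W \<Longrightarrow> (\<lambda>x. r * f x) \<in> W"
    and zero: "(\<lambda>x. 0) \<in> W"
  shows "(\<forall>g. \<exists>f\<in>W. \<forall>a\<in>A. f a = g a) \<or>
    (\<exists>c. (\<exists>a\<in>A. c a \<noteq> 0) \<and> (\<forall>f\<in>W. (\<Sum>a\<in>A. c a * f a) = 0))"
  using assms(1)
proof (induction A rule: finite_induct)
  case empty
  show ?case using zero by auto
next
  case (insert b A)
  have sum_W: "(\<lambda>x. \<Sum>a\<in>B. h a x) \<in> W" if "finite B" "\<And>a. a \<in> B \<Longrightarrow> h a \<in> W" for B :: "'a set" and h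
    using that
  proof (induction B rule: finite_induct)
    case empty
    then show ?case using zero by simp
  next
    case (insert b B)
    have "(\<lambda>x. h b x + (\<Sum>a\<in>B. h a x)) \<in> W"
      by (rule add) (use insert in auto)
    then show ?case using insert.hyps by simp
  qed
  from insert.IH show ?case
  proof (elim disjE exE conjE)
    fix c assume c: "\<exists>a\<in>A. c a \<noteq> 0" "\<forall>f\<in>W. (\<Sum>a\<in>A. c a * f a) = 0"
    have "(\<Sum>a\<in>insert b A. (if a = b then 0 else c a) * f a) = (\<Sum>a\<in>A. c a * f a)" for f
      using insert.hyps by (auto intro!: sum.cong)
    moreover from c insert.hyps have "\<exists>a\<in>insert b A. (if a = b then 0 else c a) \<noteq> 0" by force
    ultimately show ?thesis using c(2)
      by (intro disjI2 exI[of _ "\<lambda>a. if a = b then 0 else c a"]) simp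
  next
    assume onto: "\<forall>g. \<exists>f\<in>W. \<forall>a\<in>A. f a = g a"
    show ?thesis
    proof (cases "\<exists>w\<in>W. (\<forall>a\<in>A. w a = 0) \<and> w b \<noteq> 0")
      case True
      then obtain w where w: "w \<in> W" "\<forall>a\<in>A. w a = 0" "w b \<noteq> 0" by blast
      show ?thesis
      proof (intro disjI1 allI)
        fix g
        obtain f where f: "f \<in> W" "\<forall>a\<in>A. f a = g a" using onto by blast
        have "(\<lambda>x. f x + ((g b - f b) / w b) * w x) \<in> W" by (rule add[OF f(1) scale[OF w(1)]])
        then show "\<exists>f\<in>W. \<forall>a\<in>insert b A. f a = g a"
          by (rule bexI[rotated]) (use f w in auto)
      qed
    next
      case False
      \<comment> \<open>In this case the value at \<open>b\<close> is determined by the values on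
        \<open>A\<close>. With functions \<open>e a\<close> dual to the points of \<open>A\<close>,
        the determining relation has weights \<open>e a b\<close> on \<open>A\<close> and -1 at
        \<open>b\<close>.\<close>
      then have vanish: "w b = 0" if "w \<in> W" "\<forall>a\<in>A. w a = 0" for w using that by blast
      have "\<exists>f. f \<in> W \<and> (\<forall>x\<in>A. f x = (if x = a then 1 else 0))" for a
        using spec[OF onto, of "\<lambda>x. if x = a then 1 else 0"] by blast
      then obtain e where e: "\<And>a. e a \<in> W" "\<And>a x. x \<in> A \<Longrightarrow> e a x = (if x = a then 1 else (0::real))"
        using choice[of "\<lambda>a f. f \<in> W \<and> (\<forall>x\<in>A. f x = (if x = a then 1 else 0))"] by blast
      define c where "c a = (if a = b then -1 else e a b)" for a
      have "(\<Sum>a\<in>insert b A. c a * f a) = 0" if f: "f \<in> W" for f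
      proof -
        have 1: "(\<lambda>x. f x + (-1) * (\<Sum>a\<in>A. f a * e a x)) \<in> W"
          by (rule add[OF f scale], rule sum_W[OF insert.hyps(1)], rule scale, rule e(1))
        have 2: "\<forall>x\<in>A. f x + (-1) * (\<Sum>a\<in>A. f a * e a x) = 0"
          using insert.hyps by (auto simp: e(2) if_distrib cong: if_cong)
        have "f b + (-1) * (\<Sum>a\<in>A. f a * e a b) = 0" by (rule vanish[OF 1 2])
        moreover have "(\<Sum>a\<in>A. c a * f a) = (\<Sum>a\<in>A. f a * e a b)"
          using insert.hyps by (auto simp: c_def intro!: sum.cong)
        ultimately show ?thesis using insert.hyps by (simp add: c_def)
      qed
      moreover have "c b \<noteq> 0" by (simp add: c_def)
      ultimately show ?thesis by (intro disjI2 exI[of _ c]) simp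
    qed
  qed
qed

text \<open>Gaussian elimination: an equation with a nonzero coefficient at \<open>p\<close> is
  solved for the unknown \<open>p\<close>, which uses up one equation and one unknown.\<close>

lemma underdetermined_system:
  fixes M :: "'k \<Rightarrow> 'a \<Rightarrow> real"
  assumes "finite A" "finite K" "card A < card K"
  shows "\<exists>u. (\<exists>k\<in>K. u k \<noteq> 0) \<and> (\<forall>a\<in>A. (\<Sum>k\<in>K. u k * M k a) = 0)"
  using assms
proof (induction A arbitrary: K M rule: finite_induct)
  case empty
  then have "K \<noteq> {}" by auto
  then show ?case by (auto intro!: exI[of _ "\<lambda>_. 1"])
next
  case (insert b A)
  show ?case
  proof (cases "\<forall>k\<in>K. M k b = 0")
    case True
    have "card A < card K" using insert by simp
    then obtain u where "\<exists>k\<in>K. u k \<noteq> 0" "\<forall>a\<in>A. (\<Sum>k\<in>K. u k * M k a) = 0"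
      using insert.IH[OF insert.prems(1)] by blast
    then show ?thesis using True by (intro exI[of _ u]) auto
  next
    case False
    then obtain p where p: "p \<in> K" "M p b \<noteq> 0" by blast
    define M' where "M' k a = M k a - M k b / M p b * M p a" for k a
    have "card A < card (K - {p})" using insert p by simp
    then obtain u where u: "\<exists>k\<in>K - {p}. u k \<noteq> 0" "\<forall>a\<in>A. (\<Sum>k\<in>K - {p}. u k * M' k a) = 0"
      using insert.IH[of "K - {p}" M'] insert.prems by blast
    \<comment> \<open>The value at the pivot is the one forced by the equation at \<open>b\<close>;
      it turns the system for \<open>M\<close> into the reduced system for
      \<open>M'\<close>.\<close>
    define v where "v k = (if k = p then - (\<Sum>k\<in>K - {p}. u k * (M k b / M p b)) else u k)" for k
    have key: "(\<Sum>k\<in>K. v k * M k a) = (\<Sum>k\<in>K - {p}. u k * M' k a)" for a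
    proof -
      have "(\<Sum>k\<in>K. v k * M k a) = v p * M p a + (\<Sum>k\<in>K - {p}. v k * M k a)"
        using p insert.prems(1) by (simp add: sum.remove)
      also have "(\<Sum>k\<in>K - {p}. v k * M k a) = (\<Sum>k\<in>K - {p}. u k * M k a)"
        by (intro sum.cong) (auto simp: v_def)
      also have "v p * M p a = - (\<Sum>k\<in>K - {p}. u k * (M k b / M p b * M p a))"
        by (simp add: v_def sum_distrib_right mult.assoc)
      finally show ?thesis
        by (simp add: M'_def right_diff_distrib sum_subtractf)
    qed
    have "(\<Sum>k\<in>K. v k * M k a) = 0" if "a \<in> insert b A" for a
    proof (cases "a = b")
      case True
      then show ?thesis unfolding key by (intro sum.neutral) (use p in \<open>auto simp: M'_def\<close>)
    next
      case False
      then show ?thesis using that u key by auto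
    qed
    moreover have "\<exists>k\<in>K. v k \<noteq> 0" using u(1) by (auto simp: v_def)
    ultimately show ?thesis by blast
  qed
qed

subsection \<open>Polynomial functions\<close>

text \<open>Functions rather than elements of \<open>mpoly\<close>: only values matter for
  interpolation, and closure under sums and products then avoids convolutions.
  \<open>poly_fun_upto_iff\<close> translates back.\<close>

definition poly_fun_upto :: "nat \<Rightarrow> (real ^ 'n::finite \<Rightarrow> real) \<Rightarrow> bool" where
  "poly_fun_upto u g \<longleftrightarrow> (\<exists>c. \<forall>x. g x = (\<Sum>m\<in>exponents_upto u. c m * monomial_at x m))"

lemma total_degree_le_iff:
  "total_degree p \<le> u \<longleftrightarrow> Poly_Mapping.keys p \<subseteq> exponents_upto u"
  by (auto simp: total_degree_def exponents_upto_def exponent_degree_def)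

lemma mpoly_eval_eq_sum:
  assumes "total_degree p \<le> u"
  shows "mpoly_eval p x = (\<Sum>m\<in>exponents_upto u. Poly_Mapping.lookup p m * monomial_at x m)"
  unfolding mpoly_eval_def monomial_at_def
  by (rule sum.mono_neutral_left) (use assms in \<open>auto simp: total_degree_le_iff in_keys_iff\<close>)

lemma mpoly_with_coeffs:
  obtains p :: "'n::finite mpoly" where "total_degree p \<le> u"
    "\<And>m. m \<in> exponents_upto u \<Longrightarrow> Poly_Mapping.lookup p m = c m"
proof
  let ?f = "\<lambda>m. if m \<in> exponents_upto u then c m else 0"
  have "finite {m. ?f m \<noteq> 0}"
    by (rule finite_subset[OF _ finite_exponents_upto[of u]]) (auto split: if_splits)
  then have l: "Poly_Mapping.lookup (Abs_poly_mapping ?f) = ?f" by simp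
  show "Poly_Mapping.lookup (Abs_poly_mapping ?f) m = c m" if "m \<in> exponents_upto u" for m
    using that by (simp add: l)
  show "total_degree (Abs_poly_mapping ?f) \<le> u"
    unfolding total_degree_le_iff by (auto simp: in_keys_iff l split: if_splits)
qed

lemma poly_fun_upto_iff:
  fixes g :: "real ^ 'n::finite \<Rightarrow> real"
  shows "poly_fun_upto u g \<longleftrightarrow> (\<exists>p. total_degree p \<le> u \<and> (\<forall>x. mpoly_eval p x = g x))"
proof
  assume "poly_fun_upto u g"
  then obtain c where c: "\<And>x. g x = (\<Sum>m\<in>exponents_upto u. c m * monomial_at x m)"
    unfolding poly_fun_upto_def by blast
  obtain p :: "'n mpoly" where "total_degree p \<le> u"
    "\<And>m. m \<in> exponents_upto u \<Longrightarrow> Poly_Mapping.lookup p m = c m"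
    by (rule mpoly_with_coeffs[of u c]) blast
  then show "\<exists>p. total_degree p \<le> u \<and> (\<forall>x. mpoly_eval p x = g x)"
    by (intro exI[of _ p]) (simp add: mpoly_eval_eq_sum[of p u] c)
next
  assume "\<exists>p. total_degree p \<le> u \<and> (\<forall>x. mpoly_eval p x = g x)"
  then obtain p where p: "total_degree p \<le> u" "\<And>x. mpoly_eval p x = g x" by blast
  have "g x = (\<Sum>m\<in>exponents_upto u. Poly_Mapping.lookup p m * monomial_at x m)" for x
    using mpoly_eval_eq_sum[OF p(1), of x] p(2) by simp
  then show "poly_fun_upto u g" unfolding poly_fun_upto_def by blast
qed

lemma poly_fun_upto_add:
  assumes "poly_fun_upto u f" "poly_fun_upto u g"
  shows "poly_fun_upto u (\<lambda>x. f x + g x)"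
proof -
  obtain c d where "\<And>x. f x = (\<Sum>m\<in>exponents_upto u. c m * monomial_at x m)"
    "\<And>x. g x = (\<Sum>m\<in>exponents_upto u. d m * monomial_at x m)"
    using assms unfolding poly_fun_upto_def by blast
  then show ?thesis unfolding poly_fun_upto_def
    by (intro exI[of _ "\<lambda>m. c m + d m"]) (simp add: distrib_right sum.distrib)
qed

lemma poly_fun_upto_scale:
  assumes "poly_fun_upto u f"
  shows "poly_fun_upto u (\<lambda>x. r * f x)"
proof -
  obtain c where "\<And>x. f x = (\<Sum>m\<in>exponents_upto u. c m * monomial_at x m)"
    using assms unfolding poly_fun_upto_def by blast
  then show ?thesis unfolding poly_fun_upto_def
    by (intro exI[of _ "\<lambda>m. r * c m"]) (simp add: mult.assoc sum_distrib_left)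
qed

lemma poly_fun_upto_monomial:
  assumes "exponent_degree m \<le> u"
  shows "poly_fun_upto u (\<lambda>x. monomial_at x m)"
proof -
  have m: "m \<in> exponents_upto u" using assms by (simp add: exponents_upto_def)
  have "monomial_at x m = (\<Sum>a\<in>exponents_upto u. (if a = m then 1 else 0) * monomial_at x a)" for x
  proof -
    have "(\<Sum>a\<in>exponents_upto u. (if a = m then 1 else 0) * monomial_at x a)
      = (\<Sum>a\<in>exponents_upto u. if a = m then monomial_at x m else 0)"
      by (intro sum.cong) auto
    then show ?thesis using m by simp
  qed
  then show ?thesis unfolding poly_fun_upto_def by (intro exI[of _ "\<lambda>a. if a = m then 1 else 0"]) simp
qed

lemma poly_fun_upto_const [simp]: "poly_fun_upto u (\<lambda>x. r)"
  using poly_fun_upto_scale[OF poly_fun_upto_monomial[of 0 u], of r] by simp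

lemma poly_fun_upto_sum:
  assumes "finite I" "\<And>i. i \<in> I \<Longrightarrow> poly_fun_upto u (g i)"
  shows "poly_fun_upto u (\<lambda>x. \<Sum>i\<in>I. g i x)"
  using assms
proof (induction I rule: finite_induct)
  case (insert i I)
  have "poly_fun_upto u (\<lambda>x. g i x + (\<Sum>i\<in>I. g i x))"
    by (rule poly_fun_upto_add) (use insert in auto)
  then show ?case using insert.hyps by simp
qed simp

lemma poly_fun_upto_mult:
  assumes "poly_fun_upto u f" "poly_fun_upto v g"
  shows "poly_fun_upto (u + v) (\<lambda>x. f x * g x)"
proof -
  obtain c d where c: "\<And>x. f x = (\<Sum>m\<in>exponents_upto u. c m * monomial_at x m)"
    and d: "\<And>x. g x = (\<Sum>m\<in>exponents_upto v. d m * monomial_at x m)"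
    using assms unfolding poly_fun_upto_def by blast
  have "(\<lambda>x. f x * g x) = (\<lambda>x. \<Sum>m\<in>exponents_upto u. \<Sum>k\<in>exponents_upto v.
      c m * d k * monomial_at x (m + k))"
    by (rule ext) (simp add: c d sum_product monomial_at_add mult_ac)
  moreover have "poly_fun_upto (u + v) \<dots>"
    by (intro poly_fun_upto_sum finite_exponents_upto poly_fun_upto_scale poly_fun_upto_monomial)
      (simp add: exponent_degree_add exponents_upto_def add_mono)
  ultimately show ?thesis by simp
qed

lemma poly_fun_upto_prod:
  assumes "finite I" "\<And>i. i \<in> I \<Longrightarrow> poly_fun_upto (u i) (g i)"
  shows "poly_fun_upto (\<Sum>i\<in>I. u i) (\<lambda>x. \<Prod>i\<in>I. g i x)"
  using assms
proof (induction I rule: finite_induct)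
  case (insert i I)
  have "poly_fun_upto (u i + (\<Sum>i\<in>I. u i)) (\<lambda>x. g i x * (\<Prod>i\<in>I. g i x))"
    by (rule poly_fun_upto_mult) (use insert in auto)
  then show ?case using insert.hyps by simp
qed simp

lemma poly_fun_upto_linear_factor: "poly_fun_upto 1 (\<lambda>x. x $ i - r)"
  using poly_fun_upto_add[OF poly_fun_upto_monomial[of "Poly_Mapping.single i 1" 1]
      poly_fun_upto_const[of 1 "- r"]] by simp

section \<open>Interpolation by polynomials of bounded degree\<close>

definition interpolates :: "(real ^ 'n::finite) set \<Rightarrow> nat \<Rightarrow> bool" where
  "interpolates A u \<longleftrightarrow> (\<forall>f. \<exists>g. poly_fun_upto u g \<and> (\<forall>x\<in>A. g x = f x))"

lemma interpolation_degree_eq: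
  fixes Q :: "(real ^ 'n::finite) set"
  shows "interpolation_degree Q = (LEAST u. interpolates (Q \<inter> integer_points) u)"
proof -
  have "interpolates (Q \<inter> integer_points) u \<longleftrightarrow>
    (\<forall>f :: real ^ 'n \<Rightarrow> real. \<exists>p. total_degree p \<le> u \<and>
        (\<forall>x\<in>Q \<inter> integer_points. mpoly_eval p x = f x))"
    (is "_ = ?r u") for u
  proof
    assume "interpolates (Q \<inter> integer_points) u"
    then show "?r u" unfolding interpolates_def poly_fun_upto_iff by fastforce
  next
    assume r: "?r u"
    show "interpolates (Q \<inter> integer_points) u" unfolding interpolates_def poly_fun_upto_iff
    proof
      fix f :: "real ^ 'n \<Rightarrow> real"
      obtain p where "total_degree p \<le> u" "\<forall>x\<in>Q \<inter> integer_points. mpoly_eval p x = f x"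
        using r by blast
      then show "\<exists>g. (\<exists>p. total_degree p \<le> u \<and> (\<forall>x. mpoly_eval p x = g x)) \<and>
          (\<forall>x\<in>Q \<inter> integer_points. g x = f x)"
        by (intro exI[of _ "mpoly_eval p"]) auto
    qed
  qed
  then show ?thesis by (simp add: interpolation_degree_def)
qed

lemma finite_Ints_bounded: "finite {z \<in> \<int>. \<bar>z\<bar> \<le> (R::real)}"
  and card_Ints_bounded: "R \<ge> 0 \<Longrightarrow> card {z \<in> \<int>. \<bar>z\<bar> \<le> (R::real)} = nat (2 * \<lfloor>R\<rfloor> + 1)"
proof -
  have eq: "{z \<in> \<int>. \<bar>z\<bar> \<le> R} = real_of_int ` {- \<lfloor>R\<rfloor>..\<lfloor>R\<rfloor>}"
  proof (intro equalityI subsetI)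
    fix z assume "z \<in> {z \<in> \<int>. \<bar>z\<bar> \<le> R}"
    then obtain k where "z = of_int k" "\<bar>real_of_int k\<bar> \<le> R" by (auto elim: Ints_cases)
    then have "k \<in> {- \<lfloor>R\<rfloor>..\<lfloor>R\<rfloor>}" by (simp add: abs_le_iff le_floor_iff) linarith
    with \<open>z = of_int k\<close> show "z \<in> real_of_int ` {- \<lfloor>R\<rfloor>..\<lfloor>R\<rfloor>}" by blast
  next
    fix z assume "z \<in> real_of_int ` {- \<lfloor>R\<rfloor>..\<lfloor>R\<rfloor>}"
    then obtain k where k: "z = of_int k" "- \<lfloor>R\<rfloor> \<le> k" "k \<le> \<lfloor>R\<rfloor>" by auto
    then have "real_of_int k \<le> R" "real_of_int (- k) \<le> R" by linarith+
    with k(1) show "z \<in> {z \<in> \<int>. \<bar>z\<bar> \<le> R}" by auto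
  qed
  show "finite {z \<in> \<int>. \<bar>z\<bar> \<le> R}" unfolding eq by simp
  show "card {z \<in> \<int>. \<bar>z\<bar> \<le> R} = nat (2 * \<lfloor>R\<rfloor> + 1)" if "R \<ge> 0"
    unfolding eq by (subst card_image) (auto simp: inj_on_def)
qed

text \<open>Lagrange interpolation on a grid: \<open>g a\<close> has, in each coordinate, one linear
  factor for every grid value other than that of \<open>a\<close>, so it vanishes at the other
  points. There are 2 * floor R such factors per coordinate. The bound makes the interpolation
  degree well defined and at most linear in the dilation factor.\<close>

lemma interpolates_grid:
  fixes A :: "(real ^ 'n::finite) set"
  assumes A: "A \<subseteq> integer_points" "finite A" "\<And>x i. x \<in> A \<Longrightarrow> \<bar>x $ i\<bar> \<le> R" and "R \<ge> 0"
  shows "interpolates A (CARD('n) * nat (2 * \<lfloor>R\<rfloor>))"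
  unfolding interpolates_def
proof
  fix f
  define Z where "Z = {z \<in> \<int>. \<bar>z\<bar> \<le> R}"
  have fin: "finite Z" unfolding Z_def by (rule finite_Ints_bounded)
  have AZ: "x $ i \<in> Z" if "x \<in> A" for x i
    using that A(1) A(3)[OF that, of i] by (auto simp: Z_def integer_points_def)
  define N where "N = nat (2 * \<lfloor>R\<rfloor>)"
  have cN: "card (Z - {z}) = N" if "z \<in> Z" for z
  proof -
    have "card Z = nat (2 * \<lfloor>R\<rfloor> + 1)" unfolding Z_def by (rule card_Ints_bounded) fact
    then show ?thesis using that fin \<open>R \<ge> 0\<close> by (simp add: N_def nat_add_distrib)
  qed
  define g where "g a x = (\<Prod>i\<in>UNIV. \<Prod>z\<in>Z - {a $ i}. x $ i - z)" for a x :: "real ^ 'n"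
  have deg: "poly_fun_upto (CARD('n) * N) (g a)" if "a \<in> A" for a
  proof -
    have "poly_fun_upto (\<Sum>i\<in>(UNIV::'n set). \<Sum>z\<in>Z - {a $ i}. 1) (g a)"
      unfolding g_def by (intro poly_fun_upto_prod poly_fun_upto_linear_factor) (use fin in auto)
    moreover have "(\<Sum>i\<in>(UNIV::'n set). \<Sum>z\<in>Z - {a $ i}. 1) = CARD('n) * N"
      by (simp add: cN[OF AZ[OF that]])
    ultimately show ?thesis by (simp only:)
  qed
  have nz: "g a a \<noteq> 0" for a unfolding g_def using fin by auto
  have zero: "g a b = 0" if ab: "a \<in> A" "b \<in> A" "a \<noteq> b" for a b
  proof -
    obtain i where i: "a $ i \<noteq> b $ i" using ab(3) by (auto simp: vec_eq_iff)
    have "(\<Prod>z\<in>Z - {a $ i}. b $ i - z) = 0"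
      by (rule prod_zero) (use fin i AZ[OF ab(2), of i] in auto)
    then show ?thesis unfolding g_def by (intro prod_zero) auto
  qed
  define F where "F x = (\<Sum>a\<in>A. (f a / g a a) * g a x)" for x
  have "poly_fun_upto (CARD('n) * N) F"
    unfolding F_def by (intro poly_fun_upto_sum poly_fun_upto_scale deg A)
  moreover have "F x = f x" if "x \<in> A" for x
  proof -
    have "F x = (\<Sum>a\<in>A. if a = x then f x else 0)"
      unfolding F_def by (intro sum.cong) (use that nz zero in auto)
    then show ?thesis using that A(2) by simp
  qed
  ultimately show "\<exists>g. poly_fun_upto (CARD('n) * nat (2 * \<lfloor>R\<rfloor>)) g \<and> (\<forall>x\<in>A. g x = f x)"
    unfolding N_def by (intro exI[of _ F]) simp
qed

subsection \<open>Symbols\<close>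

definition moment :: "(real ^ 'n::finite) set \<Rightarrow> (real ^ 'n \<Rightarrow> real) \<Rightarrow> nat \<Rightarrow> real ^ 'n \<Rightarrow> real" where
  "moment A c k y = (\<Sum>a\<in>A. c a * (a \<bullet> y) ^ k)"

text \<open>For \<open>A\<close> consisting of integer points, \<open>c\<close> is the coefficient function of a Laurent polynomial
  \<open>\<Sum> c a X^a\<close>. Its Taylor expansion at \<open>(1,\<dots>,1)\<close> in the coordinates \<open>X = exp y\<close> has the
  homogeneous parts \<open>moment A c k y / k!\<close>, so a nonzero symbol of order \<open>k\<close> is, up to a factor,
  the leading form of a Laurent polynomial that vanishes to order exactly \<open>k\<close> at that point.\<close>

definition is_symbol :: "(real ^ 'n::finite) set \<Rightarrow> nat \<Rightarrow> (real ^ 'n \<Rightarrow> real) \<Rightarrow> bool" where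
  "is_symbol A k h \<longleftrightarrow> (\<exists>c. (\<forall>j<k. \<forall>y. moment A c j y = 0) \<and> (\<forall>y. moment A c k y = h y))"

lemma moment_scale: "moment A (\<lambda>a. r * c a) k y = r * moment A c k y"
  by (simp add: moment_def sum_distrib_left mult.assoc)

lemma is_symbol_scale:
  assumes "is_symbol A k h"
  shows "is_symbol A k (\<lambda>y. r * h y)"
proof -
  obtain c where "\<forall>j<k. \<forall>y. moment A c j y = 0" "\<forall>y. moment A c k y = h y"
    using assms unfolding is_symbol_def by blast
  then show ?thesis unfolding is_symbol_def
    by (intro exI[of _ "\<lambda>a. r * c a"]) (simp add: moment_scale)
qed

text \<open>The witness \<open>e\<close> is the convolution of \<open>c\<close> and
  \<open>d\<close>, that is, the coefficient function of the product of two Laurent polynomials. The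
  binomial theorem expresses its moments by those of \<open>c\<close> and \<open>d\<close>. Below
  order \<open>k + l\<close> every summand has a vanishing factor; at \<open>k + l\<close> only the
  summand \<open>i = k\<close> survives, and its binomial coefficient is scaled away.\<close>

lemma is_symbol_mult:
  fixes A B C :: "(real ^ 'n::finite) set"
  assumes fin: "finite A" "finite B" "finite C"
    and AB: "\<And>a b. a \<in> A \<Longrightarrow> b \<in> B \<Longrightarrow> a + b \<in> C"
    and f: "is_symbol A k f" and g: "is_symbol B l g"
  shows "is_symbol C (k + l) (\<lambda>y. f y * g y)"
proof -
  obtain c where c: "\<And>j y. j < k \<Longrightarrow> moment A c j y = 0" "\<And>y. moment A c k y = f y"
    using f unfolding is_symbol_def by blast
  obtain d where d: "\<And>j y. j < l \<Longrightarrow> moment B d j y = 0" "\<And>y. moment B d l y = g y"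
    using g unfolding is_symbol_def by blast
  define e where "e x = (\<Sum>p\<in>{p \<in> A \<times> B. fst p + snd p = x}. c (fst p) * d (snd p))" for x
  have conv: "moment C e j y = (\<Sum>i\<le>j. of_nat (j choose i) * (moment A c i y * moment B d (j - i) y))"
    for j y
  proof -
    have "moment C e j y = (\<Sum>x\<in>C. \<Sum>p\<in>{p \<in> A \<times> B. fst p + snd p = x}.
        c (fst p) * d (snd p) * ((fst p + snd p) \<bullet> y) ^ j)"
      unfolding moment_def e_def sum_distrib_right
      by (intro sum.cong refl) simp
    also have "\<dots> = (\<Sum>p\<in>A \<times> B. c (fst p) * d (snd p) * ((fst p + snd p) \<bullet> y) ^ j)"
      by (rule sum.group) (use fin AB in auto)
    also have "\<dots> = (\<Sum>a\<in>A. \<Sum>b\<in>B. c a * d b * ((a + b) \<bullet> y) ^ j)"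
      by (simp add: sum.cartesian_product case_prod_unfold)
    also have "\<dots> = (\<Sum>a\<in>A. \<Sum>b\<in>B. \<Sum>i\<le>j.
        of_nat (j choose i) * ((c a * (a \<bullet> y) ^ i) * (d b * (b \<bullet> y) ^ (j - i))))"
      by (simp add: inner_add_left binomial_ring sum_distrib_left mult_ac)
    also have "\<dots> = (\<Sum>a\<in>A. \<Sum>i\<le>j. \<Sum>b\<in>B.
        of_nat (j choose i) * ((c a * (a \<bullet> y) ^ i) * (d b * (b \<bullet> y) ^ (j - i))))"
      by (rule sum.cong[OF refl], rule sum.swap)
    also have "\<dots> = (\<Sum>i\<le>j. \<Sum>a\<in>A. \<Sum>b\<in>B.
        of_nat (j choose i) * ((c a * (a \<bullet> y) ^ i) * (d b * (b \<bullet> y) ^ (j - i))))"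
      by (rule sum.swap)
    also have "\<dots> = (\<Sum>i\<le>j. of_nat (j choose i) * (moment A c i y * moment B d (j - i) y))"
      by (simp only: moment_def sum_product) (simp only: sum_distrib_left)
    finally show ?thesis .
  qed
  have low: "moment C e j y = 0" if "j < k + l" for j y
    unfolding conv
  proof (rule sum.neutral, rule ballI)
    fix i assume "i \<in> {..j}"
    then have "i < k \<or> j - i < l" using that by auto
    then show "of_nat (j choose i) * (moment A c i y * moment B d (j - i) y) = 0"
      using c(1) d(1) by auto
  qed
  have top: "moment C e (k + l) y = of_nat ((k + l) choose k) * (f y * g y)" for y
  proof -
    have "moment A c i y * moment B d (k + l - i) y = 0" if "i \<le> k + l" "i \<noteq> k" for i
    proof -
      have "i < k \<or> k + l - i < l" using that by auto
      then show ?thesis using c(1) d(1) by auto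
    qed
    then have "moment C e (k + l) y =
      (\<Sum>i\<le>k + l. if i = k then of_nat ((k + l) choose k) * (f y * g y) else 0)"
      unfolding conv by (intro sum.cong) (auto simp: c(2) d(2))
    then show ?thesis by simp
  qed
  have "is_symbol C (k + l) (\<lambda>y. of_nat ((k + l) choose k) * (f y * g y))"
    unfolding is_symbol_def using low top by (intro exI[of _ e]) simp
  from is_symbol_scale[OF this, of "1 / of_nat ((k + l) choose k)"] show ?thesis
    by simp
qed

text \<open>Links the two sides of the duality: the coefficients of a moment as a form in
  \<open>y\<close> are, up to weights, the values of the functional given by \<open>c\<close> on the
  monomials of degree \<open>k\<close>. The weights depend on \<open>k\<close> alone, hence the
  quantification over \<open>A\<close> and \<open>c\<close> in the second conclusion.\<close>

lemma moment_expansion: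
  obtains w where "\<And>m. m \<in> exponents_of_degree k \<Longrightarrow> w m > 0"
    "\<And>A c y. moment A c k y =
      (\<Sum>m\<in>(exponents_of_degree k :: 'n::finite exponent set).
         (w m * (\<Sum>a\<in>A. c a * monomial_at a m)) * monomial_at y m)"
proof -
  obtain w where w: "\<And>m. m \<in> exponents_of_degree k \<Longrightarrow> w m > 0"
    "\<And>x y :: real ^ 'n. (x \<bullet> y) ^ k =
       (\<Sum>m\<in>exponents_of_degree k. w m * (monomial_at x m * monomial_at y m))"
    by (rule inner_power_expansion[of k]) blast
  have "moment A c k y = (\<Sum>m\<in>exponents_of_degree k.
         (w m * (\<Sum>a\<in>A. c a * monomial_at a m)) * monomial_at y m)" for A c and y :: "real ^ 'n"
  proof -
    have "moment A c k y = (\<Sum>a\<in>A. \<Sum>m\<in>exponents_of_degree k.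
        w m * (c a * monomial_at a m) * monomial_at y m)"
      by (simp add: moment_def w(2) sum_distrib_left mult_ac)
    also have "\<dots> = (\<Sum>m\<in>exponents_of_degree k. \<Sum>a\<in>A.
        w m * (c a * monomial_at a m) * monomial_at y m)"
      by (rule sum.swap)
    finally show ?thesis by (simp only: sum_distrib_left sum_distrib_right)
  qed
  with w(1) show ?thesis by (rule that)
qed

lemma moment_vanishes_iff:
  fixes A :: "(real ^ 'n::finite) set"
  shows "(\<forall>y. moment A c k y = 0) \<longleftrightarrow>
    (\<forall>m\<in>exponents_of_degree k. (\<Sum>a\<in>A. c a * monomial_at a m) = 0)"
proof -
  obtain w where w: "\<And>m. m \<in> exponents_of_degree k \<Longrightarrow> w m > 0"
    "\<And>A c y. moment A c k y = (\<Sum>m\<in>(exponents_of_degree k :: 'n exponent set).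
         (w m * (\<Sum>a\<in>A. c a * monomial_at a m)) * monomial_at y m)"
    by (rule moment_expansion[of k]) blast
  show ?thesis
  proof
    assume "\<forall>y. moment A c k y = 0"
    then have 0: "(\<Sum>m\<in>(exponents_of_degree k :: 'n exponent set).
         (w m * (\<Sum>a\<in>A. c a * monomial_at a m)) * monomial_at y m) = 0" for y
      by (simp add: w(2))
    show "\<forall>m\<in>exponents_of_degree k. (\<Sum>a\<in>A. c a * monomial_at a m) = 0"
    proof
      fix m :: "'n exponent" assume m: "m \<in> exponents_of_degree k"
      have "w m * (\<Sum>a\<in>A. c a * monomial_at a m) = 0"
        by (rule monomials_independent[OF finite_exponents_of_degree 0 m])
      then show "(\<Sum>a\<in>A. c a * monomial_at a m) = 0" using w(1)[OF m] by simp
    qed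
  next
    assume "\<forall>m\<in>exponents_of_degree k. (\<Sum>a\<in>A. c a * monomial_at a m) = 0"
    then show "\<forall>y. moment A c k y = 0" by (simp add: w(2))
  qed
qed

section \<open>Duality between interpolation and orders of vanishing\<close>

lemma sum_poly_fun_upto:
  assumes "\<And>x. g x = (\<Sum>m\<in>exponents_upto u. p m * monomial_at x m)"
  shows "(\<Sum>a\<in>A. c a * g a) = (\<Sum>m\<in>exponents_upto u. p m * (\<Sum>a\<in>A. c a * monomial_at a m))"
proof -
  have "(\<Sum>a\<in>A. c a * g a) = (\<Sum>a\<in>A. \<Sum>m\<in>exponents_upto u. p m * (c a * monomial_at a m))"
    by (simp add: assms sum_distrib_left mult_ac)
  also have "\<dots> = (\<Sum>m\<in>exponents_upto u. \<Sum>a\<in>A. p m * (c a * monomial_at a m))"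
    by (rule sum.swap)
  finally show ?thesis by (simp only: sum_distrib_left)
qed

lemma annihilates_poly_fun_upto:
  assumes "\<And>j y. j \<le> u \<Longrightarrow> moment A c j y = 0" and "poly_fun_upto u g"
  shows "(\<Sum>a\<in>A. c a * g a) = 0"
proof -
  obtain p where p: "\<And>x. g x = (\<Sum>m\<in>exponents_upto u. p m * monomial_at x m)"
    using assms(2) unfolding poly_fun_upto_def by blast
  have "(\<Sum>a\<in>A. c a * monomial_at a m) = 0" if "m \<in> exponents_upto u" for m
    using assms(1)[of "exponent_degree m"] moment_vanishes_iff[of A c "exponent_degree m"] that
    by (simp add: exponents_upto_def exponents_of_degree_def)
  then show ?thesis unfolding sum_poly_fun_upto[OF p] by simp
qed

text \<open>The zero function is a symbol of every order, so nonvanishing has to be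
  demanded.\<close>

definition order_attained :: "(real ^ 'n::finite) set \<Rightarrow> nat \<Rightarrow> bool" where
  "order_attained A k \<longleftrightarrow> (\<exists>h. is_symbol A k h \<and> (\<exists>y. h y \<noteq> 0))"

text \<open>If \<open>k > u\<close>, the coefficient function \<open>c\<close> of the symbol
  annihilates all polynomials of degree at most \<open>u\<close>. Interpolating \<open>c\<close>
  itself gives a vanishing sum of squares, so \<open>c\<close> is zero on \<open>A\<close> and the
  symbol is zero.\<close>

lemma order_attained_le_interpolation:
  assumes "finite A" "interpolates A u" "order_attained A k"
  shows "k \<le> u"
proof (rule ccontr)
  assume "\<not> k \<le> u"
  obtain h z where h: "is_symbol A k h" "h z \<noteq> 0"
    using assms(3) unfolding order_attained_def by blast
  obtain c where c: "\<And>j y. j < k \<Longrightarrow> moment A c j y = 0" "\<And>y. moment A c k y = h y"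
    using h(1) unfolding is_symbol_def by blast
  obtain g where g: "poly_fun_upto u g" "\<And>x. x \<in> A \<Longrightarrow> g x = c x"
    using assms(2) unfolding interpolates_def by blast
  have "(\<Sum>a\<in>A. c a * g a) = 0"
    by (rule annihilates_poly_fun_upto[OF _ g(1)]) (use \<open>\<not> k \<le> u\<close> c(1) in auto)
  then have "(\<Sum>a\<in>A. (c a)\<^sup>2) = 0" using g(2) by (simp add: power2_eq_square)
  then have "\<forall>a\<in>A. c a = 0" using assms(1) by (simp add: sum_nonneg_eq_0_iff)
  then have "moment A c k z = 0" by (simp add: moment_def)
  then show False using c(2) h(2) by simp
qed

text \<open>Failure of interpolation in degree \<open>s - 1\<close> yields a nonzero
  \<open>c\<close> whose moments of order below \<open>s\<close> vanish. Its first nonvanishing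
  moment therefore has order at least \<open>s\<close>, and at most \<open>s\<close> by
  \<open>order_attained_le_interpolation\<close>. Together the two lemmas identify the interpolation
  degree as the largest attained order.\<close>

lemma order_attained_Least_interpolation:
  fixes A :: "(real ^ 'n::finite) set"
  assumes "finite A" "A \<noteq> {}" "interpolates A u"
  shows "order_attained A (LEAST u. interpolates A u)"
proof -
  define s where "s = (LEAST u. interpolates A u)"
  have s: "interpolates A s" unfolding s_def using assms(3) by (rule LeastI)
  obtain c where c: "\<exists>a\<in>A. c a \<noteq> 0" "\<And>j y. j < s \<Longrightarrow> moment A c j y = 0"
  proof (cases "s = 0")
    case True
    \<comment> \<open>For \<open>s = 0\<close> no moment has to vanish, so any nonzero function on
      the nonempty set serves.\<close>
    then show ?thesis using that[of "\<lambda>_. 1"] assms(2) by auto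
  next
    case False
    then have "\<not> interpolates A (s - 1)" unfolding s_def by (intro not_less_Least) auto
    then have notW: "\<not> (\<forall>g. \<exists>f\<in>Collect (poly_fun_upto (s - 1)). \<forall>a\<in>A. f a = g a)"
      unfolding interpolates_def by auto
    have "(\<forall>g. \<exists>f\<in>Collect (poly_fun_upto (s - 1)). \<forall>a\<in>A. f a = g a) \<or>
      (\<exists>c. (\<exists>a\<in>A. c a \<noteq> 0) \<and> (\<forall>f\<in>Collect (poly_fun_upto (s - 1)). (\<Sum>a\<in>A. c a * f a) = 0))"
      by (rule interpolate_or_annihilate[OF assms(1)])
        (auto intro: poly_fun_upto_add poly_fun_upto_scale)
    with notW obtain c where c: "\<exists>a\<in>A. c a \<noteq> 0"
      "\<And>f. poly_fun_upto (s - 1) f \<Longrightarrow> (\<Sum>a\<in>A. c a * f a) = 0" by blast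
    have "\<forall>y. moment A c j y = 0" if "j < s" for j
      unfolding moment_vanishes_iff
      using that by (intro ballI c(2) poly_fun_upto_monomial) (auto simp: exponents_of_degree_def)
    then show ?thesis using that[of c] c(1) by blast
  qed
  \<comment> \<open>If all moments vanished, \<open>c\<close> would annihilate the polynomial that
    interpolates \<open>c\<close>.\<close>
  have "\<exists>k y. moment A c k y \<noteq> 0"
  proof (rule ccontr)
    assume "\<nexists>k y. moment A c k y \<noteq> 0"
    then have 0: "moment A c k y = 0" for k y by blast
    obtain g where g: "poly_fun_upto s g" "\<And>x. x \<in> A \<Longrightarrow> g x = c x"
      using s unfolding interpolates_def by blast
    have "(\<Sum>a\<in>A. c a * g a) = 0" by (rule annihilates_poly_fun_upto[OF 0 g(1)])
    then have "(\<Sum>a\<in>A. (c a)\<^sup>2) = 0" using g(2) by (simp add: power2_eq_square)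
    then have "\<forall>a\<in>A. c a = 0" using assms(1) by (simp add: sum_nonneg_eq_0_iff)
    with c(1) show False by blast
  qed
  define k where "k = (LEAST k. \<exists>y. moment A c k y \<noteq> 0)"
  have k: "\<exists>y. moment A c k y \<noteq> 0" unfolding k_def by (rule LeastI_ex) fact
  have low: "moment A c j y = 0" if "j < k" for j y
    using not_less_Least[OF that[unfolded k_def]] by blast
  have at: "order_attained A k"
    unfolding order_attained_def is_symbol_def using k low
    by (intro exI[of _ "moment A c k"] conjI exI[of _ c]) auto
  have "k \<le> s" by (rule order_attained_le_interpolation[OF assms(1) s at])
  moreover have "s \<le> k" using k c(2) by (meson not_le_imp_less)
  ultimately have "k = s" by simp
  with at show ?thesis by (simp only: s_def)
qed

section \<open>Vanishing degree and monomial symbols\<close>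

definition all_monomial_symbols :: "(real ^ 'n::finite) set \<Rightarrow> nat \<Rightarrow> bool" where
  "all_monomial_symbols A k \<longleftrightarrow>
     (\<forall>m\<in>exponents_upto k. is_symbol A (exponent_degree m) (\<lambda>y. monomial_at y m))"

lemma all_monomial_symbols_order_attained:
  assumes "all_monomial_symbols (A :: (real ^ 'n::finite) set) k"
  shows "order_attained A k"
proof -
  obtain i :: 'n where True by simp
  define m where "m = Poly_Mapping.single i k"
  have "m \<in> exponents_upto k" by (simp add: m_def exponents_upto_def)
  then have "is_symbol A (exponent_degree m) (\<lambda>y. monomial_at y m)"
    using assms unfolding all_monomial_symbols_def by blast
  then have "is_symbol A k (\<lambda>y. monomial_at y m)" by (simp only: m_def exponent_degree_single)
  moreover have "monomial_at 1 m \<noteq> 0" by (simp add: m_def)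
  ultimately show ?thesis unfolding order_attained_def by blast
qed

text \<open>Comparing coefficients in \<open>moment_expansion\<close> shows that \<open>c\<close>
  is, up to a nonzero factor, dual to \<open>m\<close> among the monomials of the same
  degree.\<close>

lemma monomial_symbol_moments:
  fixes A :: "(real ^ 'n::finite) set"
  assumes "\<And>y. moment A c (exponent_degree m) y = monomial_at y m"
  shows "(\<Sum>a\<in>A. c a * monomial_at a m) \<noteq> 0"
    and "exponent_degree b = exponent_degree m \<Longrightarrow> b \<noteq> m \<Longrightarrow> (\<Sum>a\<in>A. c a * monomial_at a b) = 0"
proof -
  let ?E = "exponents_of_degree (exponent_degree m) :: 'n exponent set"
  obtain w where w: "\<And>b. b \<in> ?E \<Longrightarrow> w b > 0"
    "\<And>A c y. moment A c (exponent_degree m) y =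
       (\<Sum>b\<in>?E. (w b * (\<Sum>a\<in>A. c a * monomial_at a b)) * monomial_at y b)"
    by (rule moment_expansion[of "exponent_degree m"]) blast
  let ?M = "\<lambda>b. \<Sum>a\<in>A. c a * monomial_at a b"
  have mE: "m \<in> ?E" by (simp add: exponents_of_degree_def)
  have "(\<Sum>b\<in>?E. (w b * ?M b - (if b = m then 1 else 0)) * monomial_at y b) = 0" for y
  proof -
    have "(\<Sum>b\<in>?E. (if b = m then 1 else 0) * monomial_at y b) = (\<Sum>b\<in>?E. if b = m then monomial_at y m else 0)"
      by (intro sum.cong) auto
    then have "(\<Sum>b\<in>?E. (if b = m then 1 else 0) * monomial_at y b) = monomial_at y m"
      using mE by simp
    then show ?thesis using assms[of y] w(2)[of A c y]
      by (simp only: left_diff_distrib sum_subtractf)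
  qed
  from monomials_independent[OF finite_exponents_of_degree this]
  have *: "w b * ?M b = (if b = m then 1 else 0)" if "b \<in> ?E" for b
    using that by fastforce
  show "?M m \<noteq> 0" using *[OF mE] by auto
  show "?M b = 0" if "exponent_degree b = exponent_degree m" "b \<noteq> m"
  proof -
    have "b \<in> ?E" using that by (simp add: exponents_of_degree_def)
    from *[OF this] w(1)[OF this] that show ?thesis by simp
  qed
qed

text \<open>Let \<open>m\<close> be a monomial of top degree in \<open>p\<close>. A \<open>c\<close>
  with symbol \<open>m\<close> kills all lower monomials and all other monomials of top degree, so
  pairing \<open>c\<close> with \<open>p\<close> isolates a nonzero multiple of the coefficient at
  \<open>m\<close>.\<close>

lemma all_monomial_symbols_imp_not_vanishing:
  fixes A :: "(real ^ 'n::finite) set"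
  assumes "all_monomial_symbols A k" "p \<noteq> 0" "total_degree p \<le> k"
  shows "\<exists>x\<in>A. mpoly_eval p x \<noteq> 0"
proof (rule ccontr)
  assume contr: "\<not> (\<exists>x\<in>A. mpoly_eval p x \<noteq> 0)"
  let ?u = "total_degree p"
  \<comment> \<open>The 0 inserted in \<open>total_degree\<close> is no obstacle: if it is the
    maximum, every exponent of the nonzero \<open>p\<close> has degree 0.\<close>
  have "\<exists>m\<in>Poly_Mapping.keys p. exponent_degree m = ?u"
  proof -
    have "?u \<in> insert 0 (exponent_degree ` Poly_Mapping.keys p)"
      unfolding total_degree_def exponent_degree_def by (intro Max_in) auto
    moreover have "Poly_Mapping.keys p \<noteq> {}" using assms(2) by simp
    moreover have "exponent_degree m \<le> ?u" if "m \<in> Poly_Mapping.keys p" for m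
      using that total_degree_le_iff[of p ?u] by (auto simp: exponents_upto_def)
    ultimately show ?thesis by fastforce
  qed
  then obtain m where m: "m \<in> Poly_Mapping.keys p" "exponent_degree m = ?u" by blast
  then have "m \<in> exponents_upto k" using assms(3) by (simp add: exponents_upto_def)
  then have "is_symbol A (exponent_degree m) (\<lambda>y. monomial_at y m)"
    using assms(1) unfolding all_monomial_symbols_def by blast
  then have "is_symbol A ?u (\<lambda>y. monomial_at y m)" by (simp only: m(2))
  then obtain c where c: "\<And>j y. j < ?u \<Longrightarrow> moment A c j y = 0"
    "\<And>y. moment A c ?u y = monomial_at y m"
    unfolding is_symbol_def by blast
  let ?M = "\<lambda>b. \<Sum>a\<in>A. c a * monomial_at a b"
  have M0: "?M b = 0" if "b \<in> exponents_upto ?u" "b \<noteq> m" for b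
  proof (cases "exponent_degree b = ?u")
    case True
    then show ?thesis using monomial_symbol_moments(2)[of A c m b] c(2) m(2) that(2) by simp
  next
    case False
    then have "exponent_degree b < ?u" using that(1) by (simp add: exponents_upto_def)
    then show ?thesis using c(1) moment_vanishes_iff[of A c "exponent_degree b"]
      by (simp add: exponents_of_degree_def)
  qed
  have "0 = (\<Sum>a\<in>A. c a * mpoly_eval p a)" using contr by simp
  also have "\<dots> = (\<Sum>b\<in>exponents_upto ?u. Poly_Mapping.lookup p b * ?M b)"
    by (rule sum_poly_fun_upto) (rule mpoly_eval_eq_sum, simp)
  also have "\<dots> = (\<Sum>b\<in>exponents_upto ?u. if b = m then Poly_Mapping.lookup p m * ?M m else 0)"
    by (intro sum.cong refl) (use M0 in auto)
  also have "\<dots> = Poly_Mapping.lookup p m * ?M m"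
  proof -
    have "m \<in> exponents_upto ?u" using m(2) by (simp add: exponents_upto_def)
    then show ?thesis by simp
  qed
  finally show False
    using m monomial_symbol_moments(1)[of A c m] c(2) by (simp add: in_keys_iff)
qed

text \<open>Here the exponents play the role of points and \<open>W\<close> consists of the monomial
  values of all functionals supported on \<open>A\<close>. An annihilator of \<open>W\<close> would
  be the coefficient vector of a nonzero polynomial vanishing on \<open>A\<close>. Hence every
  prescription of monomial values is realised; the one that is 1 at \<open>m\<close> and 0 elsewhere
  gives a multiple of the required symbol.\<close>

lemma not_vanishing_imp_all_monomial_symbols:
  fixes A :: "(real ^ 'n::finite) set"
  assumes fin: "finite A"
    and nv: "\<And>p. p \<noteq> 0 \<Longrightarrow> total_degree p \<le> k \<Longrightarrow> \<exists>x\<in>A. mpoly_eval p x \<noteq> 0"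
  shows "all_monomial_symbols A k"
proof -
  let ?E = "exponents_upto k :: 'n exponent set"
  define W where "W = range (\<lambda>c m. \<Sum>a\<in>A. c a * monomial_at a (m :: 'n exponent))"
  have "(\<forall>g. \<exists>f\<in>W. \<forall>m\<in>?E. f m = g m) \<or>
    (\<exists>q. (\<exists>m\<in>?E. q m \<noteq> 0) \<and> (\<forall>f\<in>W. (\<Sum>m\<in>?E. q m * f m) = 0))"
  proof (rule interpolate_or_annihilate)
    fix f g assume "f \<in> W" "g \<in> W"
    then obtain c d where "f = (\<lambda>m. \<Sum>a\<in>A. c a * monomial_at a m)"
      "g = (\<lambda>m. \<Sum>a\<in>A. d a * monomial_at a m)" unfolding W_def by blast
    then have "(\<lambda>x. f x + g x) = (\<lambda>m. \<Sum>a\<in>A. (c a + d a) * monomial_at a m)"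
      by (simp add: distrib_right sum.distrib)
    then show "(\<lambda>x. f x + g x) \<in> W"
      unfolding W_def by (intro range_eqI[where x = "\<lambda>a. c a + d a"]) simp
  next
    fix f r assume "f \<in> W"
    then obtain c where "f = (\<lambda>m. \<Sum>a\<in>A. c a * monomial_at a m)" unfolding W_def by blast
    then have "(\<lambda>x. r * f x) = (\<lambda>m. \<Sum>a\<in>A. (r * c a) * monomial_at a m)"
      by (simp add: sum_distrib_left mult.assoc)
    then show "(\<lambda>x. r * f x) \<in> W"
      unfolding W_def by (intro range_eqI[where x = "\<lambda>a. r * c a"]) simp
  next
    show "(\<lambda>x. 0) \<in> W" unfolding W_def by (rule range_eqI[where x = "\<lambda>a. 0"]) simp
  qed simp
  then show ?thesis
  proof (elim disjE exE conjE)
    fix q assume q: "\<exists>m\<in>?E. q m \<noteq> 0" "\<forall>f\<in>W. (\<Sum>m\<in>?E. q m * f m) = 0"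
    obtain p :: "'n mpoly" where p: "total_degree p \<le> k"
      "\<And>m. m \<in> ?E \<Longrightarrow> Poly_Mapping.lookup p m = q m"
      by (rule mpoly_with_coeffs[of k q]) blast
    have "p \<noteq> 0" using p(2) q(1) by force
    then obtain x where x: "x \<in> A" "mpoly_eval p x \<noteq> 0" using nv p(1) by blast
    \<comment> \<open>The point mass at \<open>x\<close> shows that evaluation at \<open>x\<close>
      belongs to \<open>W\<close>, so \<open>q\<close> annihilates it and \<open>p\<close> vanishes
      at \<open>x\<close>.\<close>
    have "(\<lambda>m. \<Sum>a\<in>A. (if a = x then 1 else 0) * monomial_at a m) \<in> W" unfolding W_def by (rule rangeI)
    moreover have "(\<Sum>a\<in>A. (if a = x then 1 else 0) * monomial_at a m) = monomial_at x m" for m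
    proof -
      have "(\<Sum>a\<in>A. (if a = x then 1 else 0) * monomial_at a m) = (\<Sum>a\<in>A. if a = x then monomial_at x m else 0)"
        by (intro sum.cong) auto
      then show ?thesis using fin x(1) by simp
    qed
    ultimately have "(\<lambda>m. monomial_at x m) \<in> W" by (simp only:)
    with q(2) have "(\<Sum>m\<in>?E. q m * monomial_at x m) = 0" by blast
    with x(2) show ?thesis by (simp add: mpoly_eval_eq_sum[OF p(1)] p(2))
  next
    assume onto: "\<forall>g. \<exists>f\<in>W. \<forall>m\<in>?E. f m = g m"
    show ?thesis unfolding all_monomial_symbols_def
    proof
      fix m :: "'n exponent" assume m: "m \<in> ?E"
      have mk: "exponent_degree m \<le> k" using m by (simp add: exponents_upto_def)
      from spec[OF onto, of "\<lambda>b. if b = m then 1 else 0"]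
      obtain f where f: "f \<in> W" "\<And>b. b \<in> ?E \<Longrightarrow> f b = (if b = m then 1 else 0)" by blast
      then obtain c where c: "f = (\<lambda>b. \<Sum>a\<in>A. c a * monomial_at a b)" unfolding W_def by blast
      have M: "(\<Sum>a\<in>A. c a * monomial_at a b) = (if b = m then 1 else 0)" if "b \<in> ?E" for b
        using f(2)[OF that] c by simp
      let ?j = "exponent_degree m"
      obtain w where w: "\<And>b. b \<in> exponents_of_degree ?j \<Longrightarrow> w b > 0"
        "\<And>A c y. moment A c ?j y = (\<Sum>b\<in>(exponents_of_degree ?j :: 'n exponent set).
             (w b * (\<Sum>a\<in>A. c a * monomial_at a b)) * monomial_at y b)"
        by (rule moment_expansion[of ?j]) blast
      have mE: "m \<in> exponents_of_degree ?j" by (simp add: exponents_of_degree_def)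
      have top: "moment A c ?j y = w m * monomial_at y m" for y
      proof -
        have "moment A c ?j y = (\<Sum>b\<in>(exponents_of_degree ?j :: 'n exponent set).
            if b = m then w m * monomial_at y m else 0)"
          unfolding w(2) using exponents_of_degree_subset[OF mk]
          by (intro sum.cong) (auto simp: M subset_iff)
        then show ?thesis using mE by simp
      qed
      have low: "\<forall>y. moment A c j y = 0" if "j < ?j" for j
        unfolding moment_vanishes_iff
      proof
        fix b :: "'n exponent" assume "b \<in> exponents_of_degree j"
        then have "b \<in> ?E" "b \<noteq> m" using that mk by (auto simp: exponents_of_degree_def exponents_upto_def)
        then show "(\<Sum>a\<in>A. c a * monomial_at a b) = 0" by (simp add: M)
      qed
      have "is_symbol A ?j (\<lambda>y. w m * monomial_at y m)"
        unfolding is_symbol_def using low top by (intro exI[of _ c]) simp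
      from is_symbol_scale[OF this, of "1 / w m"] w(1)[OF mE]
      show "is_symbol A ?j (\<lambda>y. monomial_at y m)" by simp
    qed
  qed
qed

text \<open>The vanishing degree exceeds \<open>k\<close> when no nonzero polynomial of degree at
  most \<open>k\<close> vanishes on the points. Thus the largest \<open>k\<close> with all monomial
  symbols is the vanishing degree minus 1, which is the superadditive quantity.\<close>

lemma less_vanishing_degree_iff:
  fixes Q :: "(real ^ 'n::finite) set"
  assumes fin: "finite (Q \<inter> integer_points)" and int: "interpolates (Q \<inter> integer_points) u"
  shows "k < vanishing_degree Q \<longleftrightarrow> all_monomial_symbols (Q \<inter> integer_points) k"
proof -
  let ?A = "Q \<inter> integer_points"
  let ?V = "\<lambda>k. \<exists>p. p \<noteq> 0 \<and> total_degree p = k \<and> (\<forall>x\<in>?A. mpoly_eval p x = 0)"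
  \<comment> \<open>Without any vanishing polynomial the order \<open>u + 1\<close> would be
    attained, contradicting interpolation in degree \<open>u\<close>. So the minimum in
    \<open>vanishing_degree\<close> exists.\<close>
  have ex: "\<exists>k. ?V k"
  proof (rule ccontr)
    assume "\<nexists>k. ?V k"
    then have "all_monomial_symbols ?A (Suc u)"
      by (intro not_vanishing_imp_all_monomial_symbols[OF fin]) blast
    from order_attained_le_interpolation[OF fin int all_monomial_symbols_order_attained[OF this]]
    show False by simp
  qed
  have V: "?V (vanishing_degree Q)" unfolding vanishing_degree_def using ex by (rule LeastI_ex)
  show ?thesis
  proof
    assume k: "k < vanishing_degree Q"
    show "all_monomial_symbols ?A k"
    proof (rule not_vanishing_imp_all_monomial_symbols[OF fin])
      fix p :: "'n mpoly" assume p: "p \<noteq> 0" "total_degree p \<le> k"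
      then have "\<not> ?V (total_degree p)"
        using k unfolding vanishing_degree_def by (intro not_less_Least) simp
      with p(1) show "\<exists>x\<in>?A. mpoly_eval p x \<noteq> 0" by blast
    qed
  next
    assume k: "all_monomial_symbols ?A k"
    show "k < vanishing_degree Q"
    proof (rule ccontr)
      assume "\<not> k < vanishing_degree Q"
      then show False
        using V all_monomial_symbols_imp_not_vanishing[OF k] by (metis not_less)
    qed
  qed
qed

section \<open>Products and linear independence of symbols\<close>

definition polynomial_on_lines :: "('a::real_vector \<Rightarrow> real) \<Rightarrow> bool" where
  "polynomial_on_lines h \<longleftrightarrow> (\<forall>x v. \<exists>p. \<forall>t. h (x + t *\<^sub>R v) = poly p t)"

lemma polynomial_on_lines_mult:
  assumes "polynomial_on_lines f" "polynomial_on_lines g"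
  shows "polynomial_on_lines (\<lambda>x. f x * g x)"
  unfolding polynomial_on_lines_def
proof (intro allI)
  fix x v
  obtain p q where "\<And>t. f (x + t *\<^sub>R v) = poly p t" "\<And>t. g (x + t *\<^sub>R v) = poly q t"
    using assms unfolding polynomial_on_lines_def by blast
  then show "\<exists>p. \<forall>t. f (x + t *\<^sub>R v) * g (x + t *\<^sub>R v) = poly p t"
    by (intro exI[of _ "p * q"]) simp
qed

lemma polynomial_on_lines_const: "polynomial_on_lines (\<lambda>x. r)"
  unfolding polynomial_on_lines_def by (intro allI exI[of _ "[:r:]"]) simp

lemma polynomial_on_lines_power:
  "polynomial_on_lines f \<Longrightarrow> polynomial_on_lines (\<lambda>x. f x ^ k)"
  by (induction k) (simp_all add: polynomial_on_lines_const polynomial_on_lines_mult)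

lemma polynomial_on_lines_prod:
  assumes "finite I" "\<And>i. i \<in> I \<Longrightarrow> polynomial_on_lines (f i)"
  shows "polynomial_on_lines (\<lambda>x. \<Prod>i\<in>I. f i x)"
  using assms
  by (induction I rule: finite_induct)
    (simp_all add: polynomial_on_lines_const polynomial_on_lines_mult)

lemma polynomial_on_lines_sum:
  assumes "finite I" "\<And>i. i \<in> I \<Longrightarrow> polynomial_on_lines (f i)"
  shows "polynomial_on_lines (\<lambda>x. \<Sum>i\<in>I. f i x)"
  unfolding polynomial_on_lines_def
proof (intro allI)
  fix x v
  have "\<forall>i\<in>I. \<exists>p. \<forall>t. f i (x + t *\<^sub>R v) = poly p t"
    using assms(2) unfolding polynomial_on_lines_def by blast
  from bchoice[OF this] obtain p where "\<And>i t. i \<in> I \<Longrightarrow> f i (x + t *\<^sub>R v) = poly (p i) t" by blast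
  then show "\<exists>p. \<forall>t. (\<Sum>i\<in>I. f i (x + t *\<^sub>R v)) = poly p t"
    by (intro exI[of _ "\<Sum>i\<in>I. p i"]) (simp add: poly_sum)
qed

lemma polynomial_on_lines_inner: "polynomial_on_lines (\<lambda>y. a \<bullet> y)"
  unfolding polynomial_on_lines_def
  by (intro allI, rule_tac x = "[:a \<bullet> x, a \<bullet> v:]" in exI) (simp add: inner_add_right)

lemma polynomial_on_lines_monomial: "polynomial_on_lines (\<lambda>y. monomial_at y m)"
proof -
  have "polynomial_on_lines (\<lambda>y. y $ i)" for i :: 'a
    using polynomial_on_lines_inner[of "axis i (1::real)"] by (simp add: inner_axis')
  then show ?thesis
    unfolding monomial_at_def
    by (intro polynomial_on_lines_prod polynomial_on_lines_power) simp_all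
qed

lemma is_symbol_polynomial_on_lines:
  assumes "finite A" "is_symbol A k h"
  shows "polynomial_on_lines h"
proof -
  obtain c where c: "\<And>y. moment A c k y = h y"
    using assms(2) unfolding is_symbol_def by blast
  have "polynomial_on_lines (\<lambda>y. \<Sum>a\<in>A. c a * (a \<bullet> y) ^ k)"
    by (intro polynomial_on_lines_sum polynomial_on_lines_mult polynomial_on_lines_const
        polynomial_on_lines_power polynomial_on_lines_inner assms(1))
  then show ?thesis by (simp add: c flip: moment_def)
qed

text \<open>On the line through \<open>x\<close> and \<open>z\<close> both functions become
  univariate polynomials, nonzero at the parameters 0 and 1 respectively, and their product has
  finitely many roots. This stands in for the polynomial ring being an integral domain.\<close>

lemma polynomial_on_lines_mult_nonzero:
  assumes f: "polynomial_on_lines f" "f x \<noteq> 0" and g: "polynomial_on_lines g" "g z \<noteq> 0"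
  shows "\<exists>y. f y * g y \<noteq> 0"
proof -
  obtain p q where p: "\<And>t. f (x + t *\<^sub>R (z - x)) = poly p t"
    and q: "\<And>t. g (x + t *\<^sub>R (z - x)) = poly q t"
    using f(1) g(1) unfolding polynomial_on_lines_def by blast
  have "poly p 0 \<noteq> 0" "poly q 1 \<noteq> 0" using f(2) g(2) p[of 0] q[of 1] by auto
  then have "p * q \<noteq> 0" by auto
  then have "finite {t. poly (p * q) t = 0}" by (rule poly_roots_finite)
  then have "{t. poly (p * q) t = 0} \<noteq> UNIV" by (metis infinite_UNIV_char_0)
  then obtain t where "poly (p * q) t \<noteq> 0" by blast
  then show ?thesis by (intro exI[of _ "x + t *\<^sub>R (z - x)"]) (simp add: p q)
qed

text \<open>If there were more symbols than points, some nontrivial combination of the coefficient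
  functions would vanish on \<open>A\<close>. Its lowest moment is a linear relation between symbols
  of one degree, which is why independence is only asked degree by degree.\<close>

lemma card_independent_symbols_le:
  fixes K :: "'k set"
  assumes fin: "finite A" "finite K"
    and sym: "\<And>k. k \<in> K \<Longrightarrow> is_symbol A (d k) (h k)"
    and indep: "\<And>j u k. (\<And>y. (\<Sum>k\<in>{k \<in> K. d k = j}. u k * h k y) = 0) \<Longrightarrow> k \<in> K \<Longrightarrow> d k = j \<Longrightarrow> u k = 0"
  shows "card K \<le> card A"
proof (rule ccontr)
  assume "\<not> card K \<le> card A"
  then have card: "card A < card K" by simp
  have "\<forall>k\<in>K. \<exists>c. (\<forall>j<d k. \<forall>y. moment A c j y = 0) \<and> (\<forall>y. moment A c (d k) y = h k y)"
    using sym unfolding is_symbol_def by blast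
  from bchoice[OF this] obtain c where
    c: "\<And>k j y. k \<in> K \<Longrightarrow> j < d k \<Longrightarrow> moment A (c k) j y = 0"
      "\<And>k y. k \<in> K \<Longrightarrow> moment A (c k) (d k) y = h k y" by blast
  obtain u where u: "\<exists>k\<in>K. u k \<noteq> 0" "\<And>a. a \<in> A \<Longrightarrow> (\<Sum>k\<in>K. u k * c k a) = 0"
    using underdetermined_system[OF fin card, of c] by blast
  \<comment> \<open>In the moment of order \<open>j\<close>, terms with larger \<open>d k\<close>
    vanish because their symbol has higher order, and those with smaller \<open>d k\<close> because
    \<open>u k = 0\<close> by minimality of \<open>j\<close>.\<close>
  define j where "j = (LEAST j. \<exists>k\<in>K. d k = j \<and> u k \<noteq> 0)"
  have "\<exists>k\<in>K. d k = j \<and> u k \<noteq> 0" unfolding j_def by (rule LeastI_ex) (use u(1) in blast)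
  then obtain p where p: "p \<in> K" "d p = j" "u p \<noteq> 0" by blast
  have low: "u k = 0" if "k \<in> K" "d k < j" for k
    using not_less_Least[OF that(2)[unfolded j_def]] that(1) by blast
  have "(\<Sum>k\<in>{k \<in> K. d k = j}. u k * h k y) = 0" for y
  proof -
    have "(\<Sum>k\<in>K. u k * moment A (c k) j y) = (\<Sum>k\<in>K. \<Sum>a\<in>A. u k * c k a * (a \<bullet> y) ^ j)"
      by (simp add: moment_def sum_distrib_left mult.assoc)
    also have "\<dots> = (\<Sum>a\<in>A. \<Sum>k\<in>K. u k * c k a * (a \<bullet> y) ^ j)" by (rule sum.swap)
    also have "\<dots> = (\<Sum>a\<in>A. (\<Sum>k\<in>K. u k * c k a) * (a \<bullet> y) ^ j)"
      by (simp only: sum_distrib_right)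
    also have "\<dots> = 0" by (rule sum.neutral) (simp add: u(2))
    finally have 0: "(\<Sum>k\<in>K. u k * moment A (c k) j y) = 0" .
    have "(\<Sum>k\<in>{k \<in> K. d k = j}. u k * h k y) = (\<Sum>k\<in>{k \<in> K. d k = j}. u k * moment A (c k) j y)"
      by (intro sum.cong refl) (use c(2) in auto)
    also have "\<dots> = (\<Sum>k\<in>K. u k * moment A (c k) j y)"
    proof (rule sum.mono_neutral_left)
      show "\<forall>k\<in>K - {k \<in> K. d k = j}. u k * moment A (c k) j y = 0"
      proof
        fix k assume k: "k \<in> K - {k \<in> K. d k = j}"
        then have "d k < j \<or> j < d k" by auto
        then show "u k * moment A (c k) j y = 0" using k low c(1) by auto
      qed
    qed (use fin in auto)
    finally show ?thesis using 0 by simp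
  qed
  from indep[OF this p(1,2)] p(3) show False by blast
qed

text \<open>By injectivity each degree contains a single block, namely a fixed power of
  \<open>h\<close> times all monomials of one degree. A relation in a block is a power of
  \<open>h\<close> times a polynomial \<open>?g\<close>; as \<open>h\<close> is not identically
  zero, \<open>?g\<close> vanishes and the monomials are independent.\<close>

lemma card_symbol_blocks_le:
  fixes A :: "(real ^ 'n::finite) set" and I :: "(nat \<times> nat) set"
  assumes fin: "finite A" "finite I"
    and h: "polynomial_on_lines h" "h z \<noteq> 0"
    and inj: "inj_on (\<lambda>(i, k). i * s + k) I"
    and sym: "\<And>i k m. (i, k) \<in> I \<Longrightarrow> exponent_degree m = k \<Longrightarrow>
      is_symbol A (i * s + k) (\<lambda>y. h y ^ i * monomial_at y m)"
  shows "(\<Sum>(i, k)\<in>I. card (exponents_of_degree k :: 'n exponent set)) \<le> card A"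
proof -
  define K where "K = (SIGMA p:I. (exponents_of_degree (snd p) :: 'n exponent set))"
  define d where "d = (\<lambda>(p, m :: 'n exponent). (case p of (i, k) \<Rightarrow> i * s + k))"
  define f where "f = (\<lambda>(p :: nat \<times> nat, m :: 'n exponent) y. h y ^ fst p * monomial_at y m)"
  have "card K \<le> card A"
  proof (rule card_independent_symbols_le[of A K d f])
    show "finite A" "finite K" using fin by (auto simp: K_def intro!: finite_SigmaI)
  next
    fix q assume "q \<in> K"
    then obtain i k m where q: "q = ((i, k), m)" "(i, k) \<in> I" "exponent_degree m = k"
      by (auto simp: K_def exponents_of_degree_def)
    show "is_symbol A (d q) (f q)" using sym[OF q(2,3)] by (simp add: q(1) d_def f_def)
  next
    fix j u q
    assume 0: "\<And>y. (\<Sum>q\<in>{q \<in> K. d q = j}. u q * f q y) = 0" and q: "q \<in> K" "d q = j"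
    obtain i k m where q': "q = ((i, k), m)" "(i, k) \<in> I" "m \<in> exponents_of_degree k"
      using q(1) by (auto simp: K_def)
    let ?E = "exponents_of_degree k :: 'n exponent set"
    have eq: "{q \<in> K. d q = j} = Pair (i, k) ` ?E"
    proof (intro equalityI subsetI)
      fix r assume "r \<in> {q \<in> K. d q = j}"
      then obtain p b where r: "r = (p, b)" "p \<in> I" "b \<in> exponents_of_degree (snd p)" "d r = j"
        by (auto simp: K_def)
      have "(case p of (i, k) \<Rightarrow> i * s + k) = (case (i, k) of (i, k) \<Rightarrow> i * s + k)"
        using r(1,4) q(2) q'(1) by (simp add: d_def)
      then have "p = (i, k)" by (rule inj_onD[OF inj _ r(2) q'(2)])
      with r show "r \<in> Pair (i, k) ` ?E" by simp
    next
      fix r assume "r \<in> Pair (i, k) ` ?E"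
      then show "r \<in> {q \<in> K. d q = j}" using q'(1,2) q(2) by (auto simp: K_def d_def)
    qed
    let ?g = "\<lambda>y. \<Sum>b\<in>?E. u ((i, k), b) * monomial_at y b"
    have 1: "h y ^ i * ?g y = 0" for y
    proof -
      have "(\<Sum>q\<in>{q \<in> K. d q = j}. u q * f q y) = (\<Sum>b\<in>?E. u ((i, k), b) * (h y ^ i * monomial_at y b))"
        unfolding eq by (subst sum.reindex) (auto simp: inj_on_def f_def)
      then show ?thesis using 0[of y] by (simp add: sum_distrib_left mult_ac)
    qed
    have g: "polynomial_on_lines ?g"
      by (intro polynomial_on_lines_sum polynomial_on_lines_mult polynomial_on_lines_const
          polynomial_on_lines_monomial finite_exponents_of_degree)
    have "?g y = 0" for y
    proof (rule ccontr)
      assume "?g y \<noteq> 0"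
      moreover have "h z ^ i \<noteq> 0" using h(2) by simp
      ultimately have "\<exists>y. h y ^ i * ?g y \<noteq> 0"
        using polynomial_on_lines_mult_nonzero[OF polynomial_on_lines_power[OF h(1)] _ g] by blast
      with 1 show False by blast
    qed
    from monomials_independent[OF finite_exponents_of_degree this q'(3)]
    show "u q = 0" by (simp add: q'(1))
  qed
  moreover have "card K = (\<Sum>(i, k)\<in>I. card (exponents_of_degree k :: 'n exponent set))"
    using fin by (simp add: K_def card_SigmaI case_prod_unfold)
  ultimately show ?thesis by simp
qed

section \<open>The number of monomials of given degree, by stars and bars\<close>

lemma card_exponents_of_degree:
  "card (exponents_of_degree k :: 'n::finite exponent set) = (k + CARD('n) - 1) choose k"
proof -
  let ?n = "CARD('n)"
  obtain g where g: "bij_betw g {0..<?n} (UNIV :: 'n set)"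
    using ex_bij_betw_nat_finite[OF finite_class.finite_UNIV] by blast
  define F where "F m = map (\<lambda>j. Poly_Mapping.lookup m (g j)) [0..<?n]" for m :: "'n exponent"
  have deg: "sum_list (F m) = exponent_degree m" for m
  proof -
    have "sum_list (F m) = (\<Sum>j = 0..<?n. Poly_Mapping.lookup m (g j))"
      unfolding F_def by (simp add: interv_sum_list_conv_sum_set_nat)
    also have "\<dots> = exponent_degree m"
      unfolding exponent_degree_def by (rule sum.reindex_bij_betw[OF g])
    finally show ?thesis .
  qed
  have "bij_betw F (exponents_of_degree k) {l. size l = ?n \<and> sum_list l = k}"
  proof (rule bij_betwI')
    fix a b :: "'n exponent"
    show "F a = F b \<longleftrightarrow> a = b"
    proof
      assume "F a = F b"
      then have eq: "Poly_Mapping.lookup a (g j) = Poly_Mapping.lookup b (g j)" if "j < ?n" for j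
        using that by (auto simp: F_def)
      show "a = b"
      proof (rule poly_mapping_eqI)
        fix i
        obtain j where "j < ?n" "i = g j" using g by (force simp: bij_betw_def)
        then show "Poly_Mapping.lookup a i = Poly_Mapping.lookup b i" using eq by simp
      qed
    qed simp
  next
    fix m :: "'n exponent" assume "m \<in> exponents_of_degree k"
    then show "F m \<in> {l. size l = ?n \<and> sum_list l = k}"
      using deg[of m] by (simp add: exponents_of_degree_def) (simp add: F_def)
  next
    fix l assume l: "l \<in> {l. size l = ?n \<and> sum_list l = k}"
    define m where "m = Abs_poly_mapping (\<lambda>i. l ! inv_into {0..<?n} g i)"
    have lk: "Poly_Mapping.lookup m = (\<lambda>i. l ! inv_into {0..<?n} g i)"
      unfolding m_def by (rule lookup_Abs_poly_mapping) simp
    have "F m = l"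
      unfolding F_def lk using l g
      by (intro nth_equalityI) (auto simp: bij_betw_def inv_into_f_f)
    then show "\<exists>m\<in>exponents_of_degree k. l = F m"
      using l deg[of m] by (intro bexI[of _ m]) (auto simp: exponents_of_degree_def)
  qed
  then have "card (exponents_of_degree k :: 'n exponent set) = card {l. size l = ?n \<and> sum_list l = k}"
    by (rule bij_betw_same_card)
  then show ?thesis by (simp only: card_length_sum_list)
qed

lemma power_le_fact_times_binomial: "real k ^ p \<le> fact p * real ((k + p) choose k)"
proof (induction p)
  case (Suc p)
  have "Suc p * ((k + Suc p) choose Suc p) = (k + Suc p) * ((k + p) choose p)"
    using Suc_times_binomial[of p "k + p"] by simp
  then have eq: "real (Suc p) * real ((k + Suc p) choose k) = real (k + Suc p) * real ((k + p) choose k)"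
    using binomial_symmetric[of k "k + Suc p"] binomial_symmetric[of k "k + p"]
    by (metis diff_add_inverse le_add1 of_nat_mult)
  have "real k ^ Suc p \<le> real k * (fact p * real ((k + p) choose k))"
    using Suc.IH by (simp add: mult_left_mono)
  also have "\<dots> \<le> real (k + Suc p) * (fact p * real ((k + p) choose k))"
    by (intro mult_right_mono) auto
  also have "\<dots> = fact p * (real (Suc p) * real ((k + Suc p) choose k))"
    by (simp only: eq mult_ac)
  also have "\<dots> = fact (Suc p) * real ((k + Suc p) choose k)" by simp
  finally show ?case .
qed simp

lemma card_exponents_of_degree_ge:
  "real k ^ (CARD('n) - 1) / fact (CARD('n) - 1)
     \<le> card (exponents_of_degree k :: 'n::finite exponent set)"
proof -
  have "k + CARD('n) - 1 = k + (CARD('n) - 1)" by simp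
  then show ?thesis
    using power_le_fact_times_binomial[of k "CARD('n) - 1"]
    by (simp add: card_exponents_of_degree divide_simps mult.commute)
qed

subsection \<open>Counting symbols on dilates\<close>

text \<open>Of the \<open>N\<close> summands, \<open>i\<close> contribute the factor
  \<open>h\<close> and each of the remaining \<open>N - i\<close> contributes a monomial of degree
  at most \<open>r\<close>. The induction adds one summand at a time; if \<open>i\<close> equals the
  number of summands, \<open>m\<close> is forced to be 0.\<close>

lemma is_symbol_dilates:
  fixes A :: "nat \<Rightarrow> (real ^ 'n::finite) set"
  assumes fin: "\<And>N. finite (A N)" and A0: "A 0 = {0}"
    and step: "\<And>N a b. a \<in> A N \<Longrightarrow> b \<in> A 1 \<Longrightarrow> a + b \<in> A (Suc N)"
    and r: "all_monomial_symbols (A 1) r" and s: "is_symbol (A 1) s h"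
  shows "i \<le> N \<Longrightarrow> exponent_degree m \<le> (N - i) * r \<Longrightarrow>
    is_symbol (A N) (i * s + exponent_degree m) (\<lambda>y. h y ^ i * monomial_at y m)"
proof (induction N arbitrary: i m)
  case 0
  then have "i = 0" "m = 0" by simp_all
  moreover have "is_symbol {0} 0 (\<lambda>y :: real ^ 'n. 1)"
    unfolding is_symbol_def by (intro exI[of _ "\<lambda>_. 1"]) (simp add: moment_def)
  ultimately show ?case by (simp add: A0)
next
  case (Suc N)
  show ?case
  proof (cases "i \<le> N")
    case True
    then have "Suc N - i = Suc (N - i)" by simp
    with Suc.prems(2) have "exponent_degree m \<le> (N - i) * r + r" by simp
    then obtain a b where ab: "m = a + b" "exponent_degree a \<le> (N - i) * r" "exponent_degree b \<le> r"
      by (rule exponent_split_degrees)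
    have "is_symbol (A 1) (exponent_degree b) (\<lambda>y. monomial_at y b)"
      using r ab(3) by (simp add: all_monomial_symbols_def exponents_upto_def)
    from is_symbol_mult[OF fin fin fin step Suc.IH[OF True ab(2)] this]
    show ?thesis by (simp add: ab(1) exponent_degree_add monomial_at_add mult.assoc add.assoc)
  next
    case False
    with Suc.prems have i: "i = Suc N" by simp
    with Suc.prems(2) have m: "m = 0" by simp
    have "is_symbol (A N) (N * s + exponent_degree (0 :: 'n exponent)) (\<lambda>y. h y ^ N * monomial_at y 0)"
      by (rule Suc.IH) simp_all
    from is_symbol_mult[OF fin fin fin step this s] show ?thesis
      by (simp add: i m mult.commute add.commute)
  qed
qed

lemma power_Suc_diff_le:
  fixes x :: real
  assumes "x \<ge> 1"
  shows "x ^ Suc p - (x - 1) ^ Suc p \<le> Suc p * x ^ p"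
proof (induction p)
  case (Suc p)
  have "x ^ Suc (Suc p) - (x - 1) ^ Suc (Suc p) = x * (x ^ Suc p - (x - 1) ^ Suc p) + (x - 1) ^ Suc p"
    by (simp add: algebra_simps)
  also have "\<dots> \<le> x * (Suc p * x ^ p) + x ^ Suc p"
    using assms Suc.IH by (intro add_mono mult_left_mono power_mono) auto
  also have "\<dots> = Suc (Suc p) * x ^ Suc p" by (simp add: algebra_simps)
  finally show ?case .
qed simp

text \<open>A comparison with the integral of the \<open>p\<close>-th power, done by telescoping
  with \<open>power_Suc_diff_le\<close>.\<close>

lemma sum_powers_ge:
  assumes "M \<ge> 1"
  shows "(real M - 1) ^ Suc p \<le> Suc p * (\<Sum>m<M. real m ^ p)"
  using assms
proof (induction M rule: dec_induct)
  case (step M)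
  have "(real (Suc M) - 1) ^ Suc p = real M ^ Suc p" by simp
  also have "\<dots> \<le> (real M - 1) ^ Suc p + Suc p * real M ^ p"
    using power_Suc_diff_le[of "real M" p] step.hyps by simp
  also have "\<dots> \<le> Suc p * (\<Sum>m<M. real m ^ p) + Suc p * real M ^ p"
    using step.IH by simp
  also have "\<dots> = Suc p * (\<Sum>m<Suc M. real m ^ p)" by (simp add: algebra_simps)
  finally show ?case .
qed simp

text \<open>The symbols \<open>h\<^sup>i y\<^sup>m\<close> have degree \<open>i s + |m|\<close> with \<open>|m| \<le> (N - i) r\<close>. In each degree we keep
  those with the smallest possible \<open>i\<close>: all \<open>|m| < N r\<close> for \<open>i = 0\<close>, and a window of length \<open>s - r\<close>
  ending at \<open>|m| = (N - i) r\<close> for the other \<open>i\<close>. Restricting to \<open>i \<le> N - s\<close> keeps the windows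
  within \<open>|m| \<ge> 0\<close> and does not affect the leading term.\<close>

lemma card_dilates_ge:
  fixes A :: "nat \<Rightarrow> (real ^ 'n::finite) set"
  assumes fin: "\<And>N. finite (A N)" and A0: "A 0 = {0}"
    and step: "\<And>N a b. a \<in> A N \<Longrightarrow> b \<in> A 1 \<Longrightarrow> a + b \<in> A (Suc N)"
    and r: "all_monomial_symbols (A 1) r" and s: "order_attained (A 1) s"
    and rs: "1 \<le> r" "r \<le> s" and N: "s < N"
  shows "real r ^ (CARD('n) - 1) * real s * (real N - real s - 1) ^ CARD('n)
    \<le> fact CARD('n) * real (card (A N))"
proof -
  obtain h z where h: "is_symbol (A 1) s h" "h z \<noteq> 0"
    using s unfolding order_attained_def by blast
  define p where "p = CARD('n) - 1"
  have n: "CARD('n) = Suc p" by (simp add: p_def)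
  define e where "e k = real k ^ p / fact p" for k :: nat
  have e_mono: "e k \<le> e l" if "k \<le> l" for k l
    unfolding e_def using that by (intro divide_right_mono power_mono) auto
  \<comment> \<open>The lower end is where the degree \<open>i * s + k\<close> passes
    \<open>(i - 1) * s + (N - i + 1) * r\<close>, the largest degree available with
    \<open>i - 1\<close> factors \<open>h\<close>.\<close>
  define W where "W i = {Suc (N - i) * r - s<..(N - i) * r}" for i
  \<comment> \<open>The value \<open>k = N * r\<close> is left out so that the range splits into
    \<open>N\<close> blocks of length \<open>r\<close>.\<close>
  define I0 where "I0 = {0::nat} \<times> {..<N * r}"
  define I1 where "I1 = (SIGMA i:{1..N - s}. W i)"
  have finI: "finite I0" "finite I1" by (auto simp: I0_def I1_def W_def)
  have I: "i \<le> N \<and> k \<le> (N - i) * r \<and> (i > 0 \<longrightarrow> Suc (N - i) * r < k + s)"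
    if "(i, k) \<in> I0 \<union> I1" for i k
    using that by (auto simp: I0_def I1_def W_def)
  \<comment> \<open>Degrees increase strictly with \<open>i\<close>: the window bound handles
    adjacent indices, and \<open>r <= s\<close> bridges the \<open>t\<close> steps beyond
    that.\<close>
  have sep: "i * s + k < i' * s + k'"
    if ik: "(i, k) \<in> I0 \<union> I1" "(i', k') \<in> I0 \<union> I1" "i < i'" for i k i' k'
  proof -
    obtain t where t: "i' = i + 1 + t" using \<open>i < i'\<close> by (metis Suc_eq_plus1 add_Suc less_iff_Suc_add)
    obtain q where q: "N = i' + q" using I[OF ik(2)] le_Suc_ex by blast
    have "k \<le> (q + 1 + t) * r" using I[OF ik(1)] by (simp add: q t algebra_simps)
    moreover have "(q + 1) * r < k' + s" using I[OF ik(2)] \<open>i < i'\<close> by (simp add: q)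
    moreover have "t * r \<le> t * s" by (rule mult_left_mono) (use rs in auto)
    ultimately show ?thesis unfolding t by (simp only: distrib_right mult_1_left)
  qed
  have inj: "inj_on (\<lambda>(i, k). i * s + k) (I0 \<union> I1)"
  proof (rule inj_onI)
    fix a b assume ab: "a \<in> I0 \<union> I1" "b \<in> I0 \<union> I1"
      and eq: "(case a of (i, k) \<Rightarrow> i * s + k) = (case b of (i, k) \<Rightarrow> i * s + k)"
    have "\<not> fst a < fst b" "\<not> fst b < fst a"
      using sep[of "fst a" "snd a" "fst b" "snd b"] sep[of "fst b" "snd b" "fst a" "snd a"] ab eq
      by (auto simp: case_prod_unfold)
    then have "fst a = fst b" by simp
    with eq show "a = b" by (simp add: case_prod_unfold prod_eq_iff)
  qed
  have "(\<Sum>(i, k)\<in>I0 \<union> I1. card (exponents_of_degree k :: 'n exponent set)) \<le> card (A N)"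
  proof (rule card_symbol_blocks_le[OF fin _ is_symbol_polynomial_on_lines[OF fin h(1)] h(2) inj])
    fix i k and m :: "'n exponent" assume "(i, k) \<in> I0 \<union> I1" "exponent_degree m = k"
    then show "is_symbol (A N) (i * s + k) (\<lambda>y. h y ^ i * monomial_at y m)"
      using is_symbol_dilates[OF fin A0 step r h(1), of i N m] I by blast
  qed (use finI in simp)
  then have "real (\<Sum>(i, k)\<in>I0 \<union> I1. card (exponents_of_degree k :: 'n exponent set)) \<le> real (card (A N))"
    by (rule of_nat_mono)
  moreover have "(\<Sum>(i, k)\<in>I0 \<union> I1. e k)
      \<le> real (\<Sum>(i, k)\<in>I0 \<union> I1. card (exponents_of_degree k :: 'n exponent set))"
    unfolding of_nat_sum
    by (rule sum_mono) (use card_exponents_of_degree_ge[where 'n = 'n] in \<open>auto simp: e_def p_def\<close>)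
  ultimately have le: "(\<Sum>(i, k)\<in>I0 \<union> I1. e k) \<le> real (card (A N))" by linarith
  have "(\<Sum>(i, k)\<in>I0 \<union> I1. e k) = (\<Sum>(i, k)\<in>I0. e k) + (\<Sum>(i, k)\<in>I1. e k)"
    by (rule sum.union_disjoint) (use finI in \<open>auto simp: I0_def I1_def\<close>)
  also have "(\<Sum>(i, k)\<in>I0. e k) = (\<Sum>k<N * r. e k)"
    by (simp add: I0_def flip: sum.cartesian_product)
  also have "(\<Sum>(i, k)\<in>I1. e k) = (\<Sum>i\<in>{1..N - s}. \<Sum>k\<in>W i. e k)"
    unfolding I1_def by (rule sum.Sigma[symmetric]) (auto simp: W_def)
  finally have split: "(\<Sum>(i, k)\<in>I0 \<union> I1. e k) = (\<Sum>k<N * r. e k) + (\<Sum>i\<in>{1..N - s}. \<Sum>k\<in>W i. e k)" .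
  \<comment> \<open>A common lower sum for both parts: \<open>i = 0\<close> contributes it with
    weight \<open>r\<close>, the windows with weight \<open>s - r\<close>, in total
    \<open>s\<close>.\<close>
  define S where "S = (\<Sum>m<N - s. e (m * r))"
  have "real r * S \<le> (\<Sum>k<N * r. e k)"
  proof -
    have "real r * S \<le> real r * (\<Sum>m<N. e (m * r))"
      unfolding S_def by (intro mult_left_mono sum_mono2) (auto simp: e_def)
    also have "\<dots> = (\<Sum>m<N. \<Sum>k\<in>{m * r..<m * r + r}. e (m * r))"
      by (simp add: sum_distrib_left)
    also have "\<dots> \<le> (\<Sum>m<N. \<Sum>k\<in>{m * r..<m * r + r}. e k)"
      by (intro sum_mono e_mono) auto
    also have "\<dots> = (\<Sum>k<N * r. e k)" by (rule sum.nat_group)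
    finally show ?thesis .
  qed
  moreover have "real (s - r) * S \<le> (\<Sum>i\<in>{1..N - s}. \<Sum>k\<in>W i. e k)"
  proof -
    have "S = (\<Sum>i\<in>{1..N - s}. e ((N - s - i) * r))"
      unfolding S_def
      by (rule sum.reindex_bij_witness[of _ "\<lambda>i. N - s - i" "\<lambda>m. N - s - m"]) auto
    then have "real (s - r) * S = (\<Sum>i\<in>{1..N - s}. real (s - r) * e ((N - s - i) * r))"
      by (simp add: sum_distrib_left)
    also have "\<dots> \<le> (\<Sum>i\<in>{1..N - s}. \<Sum>k\<in>W i. e k)"
    proof (rule sum_mono)
      fix i assume i: "i \<in> {1..N - s}"
      define q where "q = N - s - i"
      have q: "N - i = q + s" using i by (auto simp: q_def)
      \<comment> \<open>Since \<open>r >= 1\<close>, subtracting \<open>s\<close> from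
        \<open>(q + s) * r\<close> leaves at least \<open>q * r\<close>. So the natural subtraction
        in \<open>W\<close> does not truncate, and the window lies above
        \<open>q * r\<close>.\<close>
      have sr: "s \<le> s * r" using rs by simp
      have "s \<le> (q + s) * r" unfolding distrib_right using sr by linarith
      then have "card (W i) = s - r" using rs by (simp add: W_def q)
      moreover have "e (q * r) \<le> e k" if "k \<in> W i" for k
      proof (rule e_mono)
        have "Suc (q + s) * r = r + (q * r + s * r)" by (simp add: distrib_right)
        moreover have "Suc (q + s) * r - s < k" using that by (simp add: W_def q)
        ultimately show "q * r \<le> k" using sr by linarith
      qed
      ultimately show "real (s - r) * e ((N - s - i) * r) \<le> (\<Sum>k\<in>W i. e k)"
        using sum_bounded_below[of "W i" "e (q * r)" e] by (simp add: q_def)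
    qed
    finally show ?thesis .
  qed
  ultimately have "real r * S + real (s - r) * S \<le> card (A N)" using le split by linarith
  then have S: "real s * S \<le> card (A N)" using rs by (simp add: of_nat_diff algebra_simps)
  have "(real N - real s - 1) ^ Suc p \<le> Suc p * (\<Sum>m<N - s. real m ^ p)"
    using sum_powers_ge[of "N - s" p] N by (simp add: of_nat_diff)
  then have "real r ^ p * real s * (real N - real s - 1) ^ Suc p
      \<le> real r ^ p * real s * (Suc p * (\<Sum>m<N - s. real m ^ p))"
    by (intro mult_left_mono) auto
  also have "\<dots> = fact (Suc p) * (real s * S)"
    by (simp add: S_def e_def sum_distrib_left sum_distrib_right power_mult_distrib mult_ac)
  also have "\<dots> \<le> fact (Suc p) * real (card (A N))" using S by (intro mult_left_mono) auto
  finally show ?thesis by (simp add: n)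
qed

subsection \<open>Superadditive functions\<close>

text \<open>The predicate \<open>G\<close> singles out the arguments (those \<open>d\<close> for which \<open>d P\<close> contains an integer
  point) at which superadditivity is available.\<close>

lemma superadditive_converges_from_below:
  fixes f :: "real \<Rightarrow> real"
  assumes add: "\<And>d e. d > 0 \<Longrightarrow> e > 0 \<Longrightarrow> G d \<Longrightarrow> G e \<Longrightarrow> G (d + e) \<and> f d + f e \<le> f (d + e)"
    and nonneg: "\<And>d. d > 0 \<Longrightarrow> G d \<Longrightarrow> 0 \<le> f d"
    and nonpos: "\<And>d. d > 0 \<Longrightarrow> \<not> G d \<Longrightarrow> f d \<le> 0"
    and E: "E > 0" "\<And>d. d \<ge> E \<Longrightarrow> G d"
    and bound: "\<And>d. d > 0 \<Longrightarrow> f d \<le> C * d"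
    and D: "D > 0" "f D > 0"
  shows "\<exists>L>0. converges_from_below (\<lambda>d. f d / d) L"
proof -
  define L where "L = (SUP d\<in>{0<..}. f d / d)"
  have bdd: "bdd_above ((\<lambda>d. f d / d) ` {0<..})"
    by (rule bdd_aboveI2[of _ _ C]) (use bound in \<open>simp add: divide_simps\<close>)
  have le: "f d / d \<le> L" if "d > 0" for d
    unfolding L_def by (rule cSUP_upper[OF _ bdd]) (use that in simp)
  have "0 < f D / D" using D by simp
  with le[OF D(1)] have "L > 0" by linarith
  have "((\<lambda>d. f d / d) \<longlongrightarrow> L) at_top"
  proof (rule order_tendstoI)
    fix a assume "L < a"
    show "\<forall>\<^sub>F d in at_top. f d / d < a"
      using eventually_gt_at_top[of 0] by eventually_elim (use le \<open>L < a\<close> in \<open>meson le_less_trans\<close>)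
  next
    fix a assume "a < L"
    \<comment> \<open>Passing to the maximum with 0 yields a \<open>c\<close> with
      \<open>f c > 0\<close>, hence with \<open>G c\<close>.\<close>
    then have "max a 0 < L" using \<open>L > 0\<close> by simp
    then obtain c where c: "c > 0" "max a 0 < f c / c"
      unfolding L_def using less_cSUP_iff[OF _ bdd, of "max a 0"] by auto
    have fc: "f c > 0" using c by (simp add: zero_less_divide_iff)
    then have Gc: "G c" using nonpos[OF c(1)] by force
    have mult: "G (real m * c + e) \<and> real m * f c + f e \<le> f (real m * c + e)" if "e > 0" "G e" for m e
    proof (induction m)
      case (Suc m)
      have "real m * c + e > 0" using c(1) that by (simp add: add_nonneg_pos)
      from add[OF c(1) this Gc] Suc.IH show ?case by (auto simp: algebra_simps)
    qed (use that in simp)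
    have low: "f c / c * (1 - (E + c) / d) \<le> f d / d" if d: "d \<ge> E + c" for d
    proof -
      \<comment> \<open>Write \<open>d = m * c + e\<close> with \<open>e >= E\<close>: then
        \<open>G e\<close> holds and \<open>f e\<close> is nonnegative, at the cost of replacing
        \<open>d\<close> by at least \<open>d - E - c\<close> in the estimate.\<close>
      define m where "m = nat \<lfloor>(d - E) / c\<rfloor>"
      define e where "e = d - real m * c"
      have m: "real m = of_int \<lfloor>(d - E) / c\<rfloor>" using d c(1) by (simp add: m_def)
      have "real m \<le> (d - E) / c" unfolding m by simp
      then have "e \<ge> E" using c(1) by (simp add: e_def field_simps)
      then have e: "e > 0" "G e" using E by auto
      have "(d - E) / c - 1 \<le> real m" unfolding m by linarith
      then have "((d - E) / c - 1) * f c \<le> real m * f c" using fc by (intro mult_right_mono) auto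
      also have "\<dots> \<le> f d" using mult[OF e, of m] nonneg[OF e] by (simp add: e_def)
      finally have "((d - E) / c - 1) * f c / d \<le> f d / d"
        using d c(1) E(1) by (intro divide_right_mono) auto
      moreover have "((d - E) / c - 1) * f c / d = f c / c * (1 - (E + c) / d)"
        using d c(1) E(1) by (simp add: field_simps)
      ultimately show ?thesis by simp
    qed
    have "((\<lambda>d. (E + c) / d) \<longlongrightarrow> 0) at_top"
      by (intro tendsto_divide_0[OF tendsto_const] filterlim_at_top_imp_at_infinity filterlim_ident)
    then have "((\<lambda>d. f c / c * (1 - (E + c) / d)) \<longlongrightarrow> f c / c * (1 - 0)) at_top"
      by (intro tendsto_intros)
    moreover have "a < f c / c * (1 - 0)" using c by simp
    ultimately have "\<forall>\<^sub>F d in at_top. a < f c / c * (1 - (E + c) / d)" by (rule order_tendstoD)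
    then show "\<forall>\<^sub>F d in at_top. a < f d / d"
      using eventually_ge_at_top[of "E + c"]
      by eventually_elim (use low in \<open>meson less_le_trans\<close>)
  qed
  with le \<open>L > 0\<close> show ?thesis unfolding converges_from_below_def by blast
qed

subsection \<open>Integer points in dilates\<close>

lemma finite_integer_points:
  fixes Q :: "(real ^ 'n::finite) set"
  assumes "bounded Q"
  shows "finite (Q \<inter> integer_points)"
proof -
  obtain R where R: "\<And>x. x \<in> Q \<Longrightarrow> norm x \<le> R" using assms by (auto simp: bounded_iff)
  let ?Z = "{z \<in> \<int>. \<bar>z\<bar> \<le> R}"
  have "Q \<inter> integer_points \<subseteq> vec_lambda ` PiE UNIV (\<lambda>_. ?Z)"
  proof
    fix x assume x: "x \<in> Q \<inter> integer_points"
    have "x $ i \<in> ?Z" for i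
      using component_le_norm_cart[of x i] R[of x] x by (auto simp: integer_points_def)
    then have "vec_nth x \<in> PiE UNIV (\<lambda>_. ?Z)" by auto
    then have "vec_lambda (vec_nth x) \<in> vec_lambda ` PiE UNIV (\<lambda>_. ?Z)" by (rule imageI)
    then show "x \<in> vec_lambda ` PiE UNIV (\<lambda>_. ?Z)" by simp
  qed
  moreover have "finite (vec_lambda ` PiE (UNIV :: 'n set) (\<lambda>_. ?Z))"
    by (intro finite_imageI finite_PiE finite_Ints_bounded) simp
  ultimately show ?thesis by (rule finite_subset)
qed

text \<open>Divided by \<open>d + e\<close>, the sum is a convex combination of the two underlying
  points of \<open>P\<close>.\<close>

lemma convex_dilate_add:
  assumes "convex P" "a \<in> (*\<^sub>R) d ` P" "b \<in> (*\<^sub>R) e ` P" "d \<ge> 0" "e \<ge> 0"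
  shows "a + b \<in> (*\<^sub>R) (d + e) ` P"
proof -
  obtain x y where xy: "x \<in> P" "y \<in> P" "a = d *\<^sub>R x" "b = e *\<^sub>R y" using assms(2,3) by blast
  show ?thesis
  proof (cases "d + e = 0")
    case True
    then have "d = 0" "e = 0" using assms(4,5) by auto
    then show ?thesis using xy by (auto intro: image_eqI[of _ _ x])
  next
    case False
    then have pos: "d + e > 0" using assms(4,5) by simp
    have "(d / (d + e)) *\<^sub>R x + (e / (d + e)) *\<^sub>R y \<in> P"
      using assms pos xy by (intro convexD) (auto simp flip: add_divide_distrib)
    moreover have "(d + e) *\<^sub>R ((d / (d + e)) *\<^sub>R x + (e / (d + e)) *\<^sub>R y) = a + b"
      using pos xy by (simp add: scaleR_add_right)
    ultimately show ?thesis by (metis image_eqI)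
  qed
qed

lemma integer_points_add: "a \<in> integer_points \<Longrightarrow> b \<in> integer_points \<Longrightarrow> a + b \<in> integer_points"
  by (simp add: integer_points_def)

lemma dilate_integer_points_add:
  assumes "convex P" "a \<in> (*\<^sub>R) d ` P \<inter> integer_points" "b \<in> (*\<^sub>R) e ` P \<inter> integer_points"
    "d \<ge> 0" "e \<ge> 0"
  shows "a + b \<in> (*\<^sub>R) (d + e) ` P \<inter> integer_points"
  using convex_dilate_add[OF assms(1)] integer_points_add assms(2-) by blast

lemma finite_dilate_integer_points:
  fixes P :: "(real ^ 'n::finite) set"
  shows "bounded P \<Longrightarrow> finite ((*\<^sub>R) d ` P \<inter> integer_points)"
  by (intro finite_integer_points bounded_scaling)

text \<open>A convex set with empty interior lies in its frontier, which is negligible.\<close>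

lemma convex_positive_measure_interior:
  fixes P :: "'a::euclidean_space set"
  assumes "convex P" "measure lebesgue P > 0"
  obtains x r where "r > 0" "ball x r \<subseteq> P"
proof -
  have "interior P \<noteq> {}"
  proof
    assume "interior P = {}"
    then have "P \<subseteq> frontier P" using closure_subset by (auto simp: frontier_def)
    then have "negligible P" using negligible_convex_frontier[OF assms(1)] negligible_subset by blast
    then show False using assms(2) negligible_imp_measure0 by force
  qed
  then show ?thesis using that by (auto simp: mem_interior)
qed

text \<open>Rounding the centre of the dilated ball down moves it by at most n, the dimension, and a
  unit step by 1 more; a radius of at least n + 2 contains all these points.\<close>

lemma dilate_contains_unit_steps:
  fixes x :: "real ^ 'n::finite"
  assumes "ball x r \<subseteq> P" "r > 0" "d \<ge> (real CARD('n) + 2) / r"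
  obtains z where "z \<in> (*\<^sub>R) d ` P \<inter> integer_points"
    "\<And>i. z + axis i 1 \<in> (*\<^sub>R) d ` P \<inter> integer_points"
proof -
  define z :: "real ^ 'n" where "z = (\<chi> i. of_int \<lfloor>d * x $ i\<rfloor>)"
  have "(real CARD('n) + 2) / r > 0" using assms(2) by (intro divide_pos_pos) simp_all
  then have d: "d > 0" using assms(3) by linarith
  have dr: "d * r \<ge> real CARD('n) + 2" using assms(2,3) by (simp add: divide_le_eq)
  have inP: "y \<in> (*\<^sub>R) d ` P" if "norm (y - d *\<^sub>R x) < d * r" for y
  proof -
    have "norm (y /\<^sub>R d - x) = norm ((y - d *\<^sub>R x) /\<^sub>R d)" using d by (simp add: scaleR_diff_right)
    also have "\<dots> = norm (y - d *\<^sub>R x) / d" using d by (simp add: divide_inverse_commute)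
    also have "\<dots> < r" using that d by (simp add: divide_less_eq mult.commute)
    finally have "y /\<^sub>R d \<in> P" using assms(1) by (auto simp: dist_norm norm_minus_commute)
    then show ?thesis using d by (intro image_eqI[of _ _ "y /\<^sub>R d"]) auto
  qed
  have "norm (z - d *\<^sub>R x) \<le> (\<Sum>i\<in>UNIV. \<bar>(z - d *\<^sub>R x) $ i\<bar>)" by (rule norm_le_l1_cart)
  also have "\<dots> \<le> (\<Sum>i\<in>(UNIV::'n set). 1)"
  proof (rule sum_mono)
    fix i show "\<bar>(z - d *\<^sub>R x) $ i\<bar> \<le> 1" unfolding z_def by simp linarith
  qed
  finally have n: "norm (z - d *\<^sub>R x) \<le> CARD('n)" by simp
  show ?thesis
  proof (rule that[of z])
    show "z \<in> (*\<^sub>R) d ` P \<inter> integer_points"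
      using n dr by (intro IntI inP) (auto simp: z_def integer_points_def)
  next
    fix i
    have "norm (z + axis i 1 - d *\<^sub>R x) \<le> norm (z - d *\<^sub>R x) + norm (axis i (1::real) :: real ^ 'n)"
      using norm_triangle_ineq[of "z - d *\<^sub>R x" "axis i 1"] by (simp add: algebra_simps)
    then have "norm (z + axis i 1 - d *\<^sub>R x) < d * r" using n dr by simp
    then show "z + axis i 1 \<in> (*\<^sub>R) d ` P \<inter> integer_points"
      by (intro IntI inP) (auto simp: z_def integer_points_def axis_def)
  qed
qed

text \<open>The point mass at \<open>z\<close> has symbol 1, and the difference of the point masses
  at \<open>z + axis i 1\<close> and \<open>z\<close> has the symbol \<open>y $ i\<close>. This
  makes the vanishing degree of large dilates at least 2, so that the limit is positive.\<close>

lemma all_monomial_symbols_1: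
  fixes A :: "(real ^ 'n::finite) set"
  assumes "finite A" "z \<in> A" "\<And>i. z + axis i 1 \<in> A"
  shows "all_monomial_symbols A 1"
  unfolding all_monomial_symbols_def
proof
  fix m :: "'n exponent" assume "m \<in> exponents_upto 1"
  then have "exponent_degree m \<le> 1" by (simp add: exponents_upto_def)
  then have "exponent_degree m = 0 \<or> exponent_degree m = 1" by linarith
  then show "is_symbol A (exponent_degree m) (\<lambda>y. monomial_at y m)"
  proof
    assume m: "exponent_degree m = 0"
    then have "m = 0" by simp
    then show ?thesis unfolding is_symbol_def m
      by (intro exI[of _ "\<lambda>a. if a = z then 1 else 0"]) (use assms in \<open>simp add: moment_def\<close>)
  next
    assume m: "exponent_degree m = 1"
    then obtain i where i: "m = Poly_Mapping.single i 1" by (rule exponent_degree_1E)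
    define c where "c a = (if a = z + axis i 1 then 1 else 0) - (if a = z then 1 else (0::real))" for a
    have mom: "moment A c k y = ((z + axis i 1) \<bullet> y) ^ k - (z \<bullet> y) ^ k" for k y
    proof -
      have "moment A c k y = (\<Sum>a\<in>A. if a = z + axis i 1 then (a \<bullet> y) ^ k else 0)
          - (\<Sum>a\<in>A. if a = z then (a \<bullet> y) ^ k else 0)"
        unfolding moment_def sum_subtractf[symmetric] by (intro sum.cong) (auto simp: c_def)
      then show ?thesis using assms by simp
    qed
    show ?thesis unfolding is_symbol_def m
      by (intro exI[of _ c]) (simp add: mom i inner_add_left inner_axis')
  qed
qed

subsection \<open>Volume\<close>

text \<open>The compact neighbourhoods shrink to the closure, whose measure is that of
  \<open>P\<close> because the frontier of a convex set is negligible; continuity of measure from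
  above applies.\<close>

lemma measure_neighbourhood_small:
  fixes P :: "'a::euclidean_space set"
  assumes "bounded P" "convex P" "P \<noteq> {}" "\<epsilon> > 0"
  obtains \<delta> where "\<delta> > 0" "measure lebesgue {y. infdist y (closure P) \<le> \<delta>} < measure lebesgue P + \<epsilon>"
proof -
  define N where "N k = {y. infdist y (closure P) \<le> 1 / real (Suc k)}" for k
  have comp: "compact (N k)" for k
    unfolding N_def
    by (rule compact_infdist_le) (use assms in \<open>auto simp: compact_closure\<close>)
  have "(\<lambda>k. measure lebesgue (N k)) \<longlonglongrightarrow> measure lebesgue (\<Inter>k. N k)"
  proof (rule Lim_measure_decseq)
    show "range N \<subseteq> sets lebesgue" using lmeasurable_compact[OF comp] by auto
    show "decseq N"
    proof (rule decseq_SucI)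
      fix k
      have "1 / real (Suc (Suc k)) \<le> 1 / real (Suc k)" by (simp add: divide_simps)
      then show "N (Suc k) \<subseteq> N k" unfolding N_def by (auto intro: order_trans)
    qed
    show "emeasure lebesgue (N k) \<noteq> \<infinity>" for k
      using fmeasurableD2[OF lmeasurable_compact[OF comp]] by simp
  qed
  moreover have "(\<Inter>k. N k) = closure P"
  proof (intro equalityI subsetI)
    fix y assume "y \<in> (\<Inter>k. N k)"
    then have le: "infdist y (closure P) \<le> 1 / real (Suc k)" for k by (auto simp: N_def)
    have "(\<lambda>k. 1 / real (Suc k)) \<longlonglongrightarrow> 0" by (rule LIMSEQ_Suc[OF lim_1_over_n])
    then have "infdist y (closure P) \<le> 0"
      by (rule LIMSEQ_le_const) (use le in blast)
    then have "infdist y (closure P) = 0" using infdist_nonneg[of y "closure P"] by simp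
    then show "y \<in> closure P" using in_closure_iff_infdist_zero[of "closure P" y] assms(3) by simp
  next
    fix y assume "y \<in> closure P"
    then have "infdist y (closure P) = 0" using in_closure_iff_infdist_zero[of "closure P" y] assms(3) by simp
    then show "y \<in> (\<Inter>k. N k)" by (simp add: N_def)
  qed
  moreover have "measure lebesgue (closure P) = measure lebesgue P"
  proof (rule measure_negligible_symdiff)
    show "P \<in> lmeasurable" by (rule measurable_convex[OF assms(2,1)])
    have "P - closure P \<union> (closure P - P) \<subseteq> frontier P"
      using closure_subset interior_subset by (auto simp: frontier_def)
    then show "negligible (P - closure P \<union> (closure P - P))"
      using negligible_convex_frontier[OF assms(2)] negligible_subset by blast
  qed
  ultimately have "(\<lambda>k. measure lebesgue (N k)) \<longlonglongrightarrow> measure lebesgue P" by simp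
  from order_tendstoD(2)[OF this, of "measure lebesgue P + \<epsilon>"] assms(4)
  have "\<forall>\<^sub>F k in sequentially. measure lebesgue (N k) < measure lebesgue P + \<epsilon>" by simp
  then obtain k where "measure lebesgue (N k) < measure lebesgue P + \<epsilon>"
    by (auto simp: eventually_sequentially)
  then show ?thesis using that[of "1 / real (Suc k)"] by (simp add: N_def)
qed

text \<open>Open unit cubes attached to distinct integer points are disjoint. Those at points of the
  dilate stay within distance \<open>CARD('n)\<close> of it, hence inside the dilate by
  \<open>t\<close> of the \<delta>-neighbourhood.\<close>

lemma card_dilate_integer_points_le:
  fixes P :: "(real ^ 'n::finite) set" and t \<delta> :: real
  assumes P: "bounded P" and t: "t > 0" "CARD('n) \<le> t * \<delta>" and ne: "P \<noteq> {}"
  shows "card ((*\<^sub>R) t ` P \<inter> integer_points) \<le> t ^ CARD('n) * measure lebesgue {y. infdist y (closure P) \<le> \<delta>}"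
proof -
  let ?A = "(*\<^sub>R) t ` P \<inter> integer_points" and ?N = "{y. infdist y (closure P) \<le> \<delta>}"
  have fin: "finite ?A" by (rule finite_dilate_integer_points[OF P])
  define B where "B z = box z (z + One)" for z :: "real ^ 'n"
  have memB: "y \<in> B z \<longleftrightarrow> (\<forall>i. z $ i < y $ i \<and> y $ i < z $ i + 1)" for y z
  proof -
    have "(One :: real ^ 'n) $ i = 1" for i
      by (simp add: cart_eq_inner_axis axis_in_Basis_iff inner_sum_left_Basis)
    then show ?thesis by (simp add: B_def mem_box_cart)
  qed
  have disj: "pairwise (\<lambda>z w. disjnt (B z) (B w)) ?A"
  proof (rule pairwiseI)
    fix z w assume zw: "z \<in> ?A" "w \<in> ?A" "z \<noteq> w"
    show "disjnt (B z) (B w)"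
    proof (rule ccontr)
      assume "\<not> disjnt (B z) (B w)"
      then obtain y where y: "y \<in> B z" "y \<in> B w" by (auto simp: disjnt_def)
      have "z $ i = w $ i" for i
      proof -
        have "z $ i \<in> \<int>" "w $ i \<in> \<int>" using zw by (auto simp: integer_points_def)
        then obtain k l where kl: "z $ i = of_int k" "w $ i = of_int l" by (auto elim!: Ints_cases)
        have "z $ i < y $ i" "y $ i < z $ i + 1" "w $ i < y $ i" "y $ i < w $ i + 1"
          using y unfolding memB by auto
        then have "k = l" unfolding kl by linarith
        with kl show ?thesis by simp
      qed
      then show False using zw(3) by (simp add: vec_eq_iff)
    qed
  qed
  have meas: "B z \<in> lmeasurable" for z by (simp add: B_def)
  have one: "measure lebesgue (B z) = 1" for z
    unfolding B_def by (simp add: measure_lborel_box_eq inner_add_left)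
  have "real (card ?A) = (\<Sum>z\<in>?A. measure lebesgue (B z))" by (simp add: one)
  also have "\<dots> = measure lebesgue (\<Union>z\<in>?A. B z)"
    by (rule measure_UNION'[symmetric]) (use fin meas disj in auto)
  also have "\<dots> \<le> measure lebesgue ((\<lambda>x. t *\<^sub>R x + 0) ` ?N)"
  proof (rule measure_mono_fmeasurable)
    show "(\<Union>z\<in>?A. B z) \<subseteq> (\<lambda>x. t *\<^sub>R x + 0) ` ?N"
    proof
      fix y assume "y \<in> (\<Union>z\<in>?A. B z)"
      then obtain p where p: "p \<in> P" "y \<in> B (t *\<^sub>R p)" by blast
      have "norm (y - t *\<^sub>R p) \<le> (\<Sum>i\<in>UNIV. \<bar>(y - t *\<^sub>R p) $ i\<bar>)" by (rule norm_le_l1_cart)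
      also have "\<dots> \<le> (\<Sum>i\<in>(UNIV::'n set). 1)"
      proof (rule sum_mono)
        fix i show "\<bar>(y - t *\<^sub>R p) $ i\<bar> \<le> 1"
          using p(2) unfolding memB by (auto simp: abs_le_iff dest!: spec[of _ i])
      qed
      finally have n: "norm (y - t *\<^sub>R p) \<le> t * \<delta>" using t(2) by simp
      have "dist (y /\<^sub>R t) p = norm ((y - t *\<^sub>R p) /\<^sub>R t)"
        using t(1) by (simp add: dist_norm scaleR_diff_right)
      also have "\<dots> = norm (y - t *\<^sub>R p) / t" using t(1) by (simp add: divide_inverse_commute)
      also have "\<dots> \<le> \<delta>" using n t(1) by (simp add: divide_le_eq mult.commute)
      finally have "y /\<^sub>R t \<in> ?N" using infdist_le2[of p "closure P"] p(1) closure_subset by blast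
      then show "y \<in> (\<lambda>x. t *\<^sub>R x + 0) ` ?N"
        using t(1) by (intro image_eqI[of _ _ "y /\<^sub>R t"]) auto
    qed
    have "0 < real CARD('n)" by simp
    also have "\<dots> \<le> t * \<delta>" by (rule t(2))
    finally have "\<delta> > 0" using t(1) by (simp add: zero_less_mult_iff)
    then have "compact ?N"
      using compact_infdist_le[of "closure P" \<delta>] P ne by (simp add: compact_closure)
    then have "compact ((\<lambda>x. t *\<^sub>R x) ` ?N)" by (rule compact_scaling)
    then show "(\<lambda>x. t *\<^sub>R x + 0) ` ?N \<in> lmeasurable" by (simp add: lmeasurable_compact)
    show "(\<Union>z\<in>?A. B z) \<in> sets lebesgue" using meas fin by (intro sets.finite_UN) auto
  qed
  also have "\<dots> = t ^ CARD('n) * measure lebesgue ?N"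
    using t(1) by (subst measure_lebesgue_affine) simp
  finally show ?thesis .
qed

text \<open>With \<open>d\<close>, \<open>r\<close> and \<open>s\<close> fixed, the integer points
  of the dilate by \<open>N * d\<close> are counted from below by symbols and from above by volume.
  Dividing by the \<open>CARD('n)\<close>-th power of \<open>N\<close> and letting \<open>N\<close>
  grow removes the error terms; then \<epsilon> tends to 0.\<close>

lemma symbols_volume_inequality:
  fixes P :: "(real ^ 'n::finite) set"
  assumes P: "bounded P" "convex P" "P \<noteq> {}" and d: "d > 0"
    and r: "all_monomial_symbols ((*\<^sub>R) d ` P \<inter> integer_points) r"
    and s: "order_attained ((*\<^sub>R) d ` P \<inter> integer_points) s"
    and rs: "1 \<le> r" "r \<le> s"
  shows "real r ^ (CARD('n) - 1) * real s \<le> fact CARD('n) * d ^ CARD('n) * measure lebesgue P"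
proof -
  let ?X = "real r ^ (CARD('n) - 1) * real s" and ?F = "fact CARD('n) * d ^ CARD('n)"
    and ?n = "CARD('n)"
  have F: "?F > 0" using d by simp
  define A where "A N = (*\<^sub>R) (real N * d) ` P \<inter> integer_points" for N
  have "?X \<le> ?F * (measure lebesgue P + \<epsilon>)" if \<epsilon>: "\<epsilon> > 0" for \<epsilon>
  proof -
    obtain \<delta> where \<delta>: "\<delta> > 0" "measure lebesgue {y. infdist y (closure P) \<le> \<delta>} < measure lebesgue P + \<epsilon>"
      by (rule measure_neighbourhood_small[OF P \<epsilon>])
    let ?V = "measure lebesgue {y. infdist y (closure P) \<le> \<delta>}"
    have fin: "finite (A N)" for N unfolding A_def by (rule finite_dilate_integer_points[OF P(1)])
    have A0: "A 0 = {0}"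
      using P(3) by (auto simp: A_def integer_points_def)
    have A1: "A 1 = (*\<^sub>R) d ` P \<inter> integer_points" by (simp add: A_def)
    have step: "a + b \<in> A (Suc N)" if "a \<in> A N" "b \<in> A 1" for a b N
      using dilate_integer_points_add[OF P(2), of a "real N * d" b d] that d
      by (simp add: A_def distrib_right add.commute)
    have le: "?X * (1 - (real s + 1) / real N) ^ ?n \<le> ?F * ?V"
      if N: "s < N" "?n / (d * \<delta>) \<le> real N" for N
    proof -
      have N0: "real N > 0" using N(1) by simp
      have "real ?n \<le> real N * d * \<delta>" using N(2) d \<delta>(1) by (simp add: field_simps)
      then have card: "card (A N) \<le> (real N * d) ^ ?n * ?V"
        unfolding A_def using N0 d P by (intro card_dilate_integer_points_le) auto
      have "?X * (real N - real s - 1) ^ ?n \<le> fact ?n * real (card (A N))"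
        by (rule card_dilates_ge[OF fin A0 step r[folded A1] s[folded A1] rs N(1)])
      also have "\<dots> \<le> fact ?n * ((real N * d) ^ ?n * ?V)"
        using card by (intro mult_left_mono) auto
      also have "\<dots> = ?F * ?V * real N ^ ?n" by (simp add: power_mult_distrib mult_ac)
      finally have "?X * (real N - real s - 1) ^ ?n / real N ^ ?n \<le> ?F * ?V"
        using N0 by (simp add: divide_le_eq)
      moreover have "1 - (real s + 1) / real N = (real N - real s - 1) / real N"
        using N0 by (simp add: field_simps)
      ultimately show ?thesis by (simp add: power_divide)
    qed
    have "(\<lambda>N. ?X * (1 - (real s + 1) / real N) ^ ?n) \<longlonglongrightarrow> ?X * (1 - 0) ^ ?n"
      by (intro tendsto_intros lim_const_over_n)
    moreover have "\<forall>\<^sub>F N in sequentially. ?X * (1 - (real s + 1) / real N) ^ ?n \<le> ?F * ?V"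
    proof -
      have "\<forall>\<^sub>F N in sequentially. ?n / (d * \<delta>) \<le> real N"
        using filterlim_real_sequentially by (simp add: filterlim_at_top)
      then show ?thesis using eventually_gt_at_top[of s] by eventually_elim (use le in blast)
    qed
    ultimately have "?X * (1 - 0) ^ ?n \<le> ?F * ?V"
      by (rule tendsto_upperbound) simp
    also have "\<dots> \<le> ?F * (measure lebesgue P + \<epsilon>)" using \<delta>(2) F by (intro mult_left_mono) auto
    finally show ?thesis by simp
  qed
  then have "?X / ?F \<le> measure lebesgue P + \<epsilon>" if "\<epsilon> > 0" for \<epsilon>
    using that F by (simp add: divide_le_eq mult.commute)
  then have "?X / ?F \<le> measure lebesgue P" by (rule field_le_epsilon)
  then show ?thesis using F by (simp add: divide_le_eq mult.commute)
qed

section \<open>Superadditivity of both degrees under sums of sets\<close>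

lemma order_attained_add:
  fixes A B C :: "(real ^ 'n::finite) set"
  assumes fin: "finite A" "finite B" "finite C"
    and AB: "\<And>a b. a \<in> A \<Longrightarrow> b \<in> B \<Longrightarrow> a + b \<in> C"
    and "order_attained A k" "order_attained B l"
  shows "order_attained C (k + l)"
proof -
  obtain f x where f: "is_symbol A k f" "f x \<noteq> 0"
    using assms(5) unfolding order_attained_def by blast
  obtain g z where g: "is_symbol B l g" "g z \<noteq> 0"
    using assms(6) unfolding order_attained_def by blast
  have "\<exists>y. f y * g y \<noteq> 0"
    by (rule polynomial_on_lines_mult_nonzero
        [OF is_symbol_polynomial_on_lines[OF fin(1) f(1)] f(2)
            is_symbol_polynomial_on_lines[OF fin(2) g(1)] g(2)])
  with is_symbol_mult[OF fin AB f(1) g(1)] show ?thesis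
    unfolding order_attained_def by (intro exI[of _ "\<lambda>y. f y * g y"] conjI)
qed

text \<open>A monomial of degree at most \<open>k + l\<close> factors into monomials of degree at
  most \<open>k\<close> and \<open>l\<close>, and symbols multiply.\<close>

lemma all_monomial_symbols_add:
  fixes A B C :: "(real ^ 'n::finite) set"
  assumes fin: "finite A" "finite B" "finite C"
    and AB: "\<And>a b. a \<in> A \<Longrightarrow> b \<in> B \<Longrightarrow> a + b \<in> C"
    and A: "all_monomial_symbols A k" and B: "all_monomial_symbols B l"
  shows "all_monomial_symbols C (k + l)"
  unfolding all_monomial_symbols_def
proof
  fix m :: "'n exponent" assume "m \<in> exponents_upto (k + l)"
  then have "exponent_degree m \<le> k + l" by (simp add: exponents_upto_def)
  then obtain a b where ab: "m = a + b" "exponent_degree a \<le> k" "exponent_degree b \<le> l"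
    by (rule exponent_split_degrees)
  have a: "is_symbol A (exponent_degree a) (\<lambda>y. monomial_at y a)"
    using A ab(2) by (simp add: all_monomial_symbols_def exponents_upto_def)
  have b: "is_symbol B (exponent_degree b) (\<lambda>y. monomial_at y b)"
    using B ab(3) by (simp add: all_monomial_symbols_def exponents_upto_def)
  from is_symbol_mult[OF fin AB a b]
  show "is_symbol C (exponent_degree m) (\<lambda>y. monomial_at y m)"
    by (simp add: ab(1) exponent_degree_add monomial_at_add)
qed

lemma all_monomial_symbols_0_iff:
  fixes A :: "(real ^ 'n::finite) set"
  assumes "finite A"
  shows "all_monomial_symbols A 0 \<longleftrightarrow> A \<noteq> {}"
proof -
  have "exponents_upto 0 = {0 :: 'n exponent}" by (auto simp: exponents_upto_def)
  then have eq: "all_monomial_symbols A 0 \<longleftrightarrow> is_symbol A 0 (\<lambda>y. 1)"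
    by (simp add: all_monomial_symbols_def)
  show ?thesis
  proof
    assume "all_monomial_symbols A 0"
    then show "A \<noteq> {}" unfolding eq is_symbol_def by (auto simp: moment_def)
  next
    assume "A \<noteq> {}"
    then obtain a where "a \<in> A" by blast
    then show "all_monomial_symbols A 0" unfolding eq is_symbol_def
      by (intro exI[of _ "\<lambda>x. if x = a then 1 else 0"]) (simp add: moment_def assms)
  qed
qed

section \<open>Existence of the limits and the volume bound\<close>

theorem corollary10:
  fixes P :: "(real ^ 'n::finite) set"
  assumes "bounded P" and "convex P" and "measure lebesgue P > 0"
  shows "\<exists>v w :: real. v > 0 \<and> w > 0 \<and>
    converges_from_below (\<lambda>d. (real (vanishing_degree ((*\<^sub>R) d ` P)) - 1) / d) v \<and>
    converges_from_below (\<lambda>d. real (interpolation_degree ((*\<^sub>R) d ` P)) / d) w \<and>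
    v ^ (CARD('n) - 1) * w \<le> fact CARD('n) * measure lebesgue P"
proof -
  let ?n = "CARD('n)"
  obtain x0 r0 where r0: "r0 > 0" "ball x0 r0 \<subseteq> P"
    by (rule convex_positive_measure_interior[OF assms(2,3)])
  have ne: "P \<noteq> {}" using assms(3) by auto
  obtain R where R: "R > 0" "\<And>x. x \<in> P \<Longrightarrow> norm x \<le> R"
    using assms(1) unfolding bounded_pos by blast
  define A where "A d = (*\<^sub>R) d ` P \<inter> integer_points" for d
  define s where "s d = interpolation_degree ((*\<^sub>R) d ` P)" for d
  define r where "r d = vanishing_degree ((*\<^sub>R) d ` P)" for d
  have fin: "finite (A d)" for d unfolding A_def by (rule finite_dilate_integer_points[OF assms(1)])
  have AA: "a + b \<in> A (d + e)" if "a \<in> A d" "b \<in> A e" "d > 0" "e > 0" for a b d e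
    using dilate_integer_points_add[OF assms(2), of a d b e] that by (simp add: A_def)
  \<comment> \<open>The slope comes from \<open>interpolates_grid\<close>: the coordinates on the
    dilate by \<open>d\<close> are at most \<open>d * R\<close> in absolute value.\<close>
  define C where "C = real ?n * (2 * R)"
  have int: "interpolates (A d) (?n * nat (2 * \<lfloor>d * R\<rfloor>))" if "d > 0" for d
  proof (rule interpolates_grid[OF _ fin])
    fix x i assume "x \<in> A d"
    then obtain y where y: "y \<in> P" "x = d *\<^sub>R y" by (auto simp: A_def)
    have "\<bar>x $ i\<bar> \<le> norm x" by (rule component_le_norm_cart)
    also have "\<dots> \<le> d * R" using y R(2)[OF y(1)] that by simp
    finally show "\<bar>x $ i\<bar> \<le> d * R" .
  qed (use that R(1) in \<open>auto simp: A_def\<close>)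
  have s_eq: "s d = (LEAST u. interpolates (A d) u)" for d
    by (simp add: s_def A_def interpolation_degree_eq)
  have s_bound: "real (s d) \<le> C * d" if "d > 0" for d
  proof -
    have "s d \<le> ?n * nat (2 * \<lfloor>d * R\<rfloor>)" unfolding s_eq by (rule Least_le) (rule int[OF that])
    then have "real (s d) \<le> real (?n * nat (2 * \<lfloor>d * R\<rfloor>))" by (rule of_nat_mono)
    also have "\<dots> = real ?n * (2 * of_int \<lfloor>d * R\<rfloor>)" using that R(1) by simp
    also have "\<dots> \<le> real ?n * (2 * (d * R))" by (intro mult_left_mono) auto
    finally show ?thesis by (simp add: C_def mult_ac)
  qed
  have s_attained: "order_attained (A d) (s d)" if "d > 0" "A d \<noteq> {}" for d
    unfolding s_eq by (rule order_attained_Least_interpolation[OF fin that(2) int[OF that(1)]])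
  have s_max: "k \<le> s d" if "d > 0" "order_attained (A d) k" for d k
  proof (rule order_attained_le_interpolation[OF fin _ that(2)])
    show "interpolates (A d) (s d)" unfolding s_eq by (rule LeastI) (rule int[OF that(1)])
  qed
  have r_iff: "k < r d \<longleftrightarrow> all_monomial_symbols (A d) k" if "d > 0" for d k
    unfolding r_def A_def
    by (rule less_vanishing_degree_iff) (use fin int[OF that] in \<open>auto simp: A_def\<close>)
  \<comment> \<open>A nonzero constant vanishes on the empty set only, so the vanishing degree is 0
    exactly when the dilate has no integer point. Such \<open>d\<close> are excluded from
    superadditivity.\<close>
  have r_pos_iff: "0 < r d \<longleftrightarrow> A d \<noteq> {}" if "d > 0" for d
    unfolding r_iff[OF that] by (rule all_monomial_symbols_0_iff[OF fin])
  have r_le_s: "r d - 1 \<le> s d" if "d > 0" "A d \<noteq> {}" for d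
  proof -
    have "r d - 1 < r d" using r_pos_iff[OF that(1)] that(2) by simp
    then show ?thesis
      unfolding r_iff[OF that(1)] by (intro s_max[OF that(1)] all_monomial_symbols_order_attained)
  qed
  \<comment> \<open>The threshold of \<open>dilate_contains_unit_steps\<close>, beyond which the
    vanishing degree is at least 2.\<close>
  define E where "E = (real ?n + 2) / r0"
  have E: "E > 0" unfolding E_def using r0(1) by (simp add: add_nonneg_pos)
  have r_large: "1 < r d" and ne_large: "A d \<noteq> {}" if dE: "d \<ge> E" for d
  proof -
    have d: "d > 0" using dE E by simp
    obtain z where z: "z \<in> A d" "\<And>i. z + axis i 1 \<in> A d"
      by (rule dilate_contains_unit_steps[OF r0(2,1) dE[unfolded E_def], folded A_def]) blast
    then show "A d \<noteq> {}" by blast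
    show "1 < r d" unfolding r_iff[OF d] by (rule all_monomial_symbols_1[OF fin z])
  qed
  have "\<exists>v>0. converges_from_below (\<lambda>d. (real (r d) - 1) / d) v"
  proof (rule superadditive_converges_from_below[where G = "\<lambda>d. A d \<noteq> {}" and E = E and C = C and D = E])
    fix d e :: real assume de: "d > 0" "e > 0" "A d \<noteq> {}" "A e \<noteq> {}"
    have pos: "0 < r d" "0 < r e" using r_pos_iff de by auto
    then have "all_monomial_symbols (A d) (r d - 1)" "all_monomial_symbols (A e) (r e - 1)"
      unfolding r_iff[OF de(1), symmetric] r_iff[OF de(2), symmetric] by auto
    then have "all_monomial_symbols (A (d + e)) ((r d - 1) + (r e - 1))"
      by (intro all_monomial_symbols_add[OF fin fin fin AA[OF _ _ de(1,2)]])
    then have "(r d - 1) + (r e - 1) < r (d + e)" using r_iff[of "d + e"] de by simp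
    moreover from this have "0 < r (d + e)" by simp
    ultimately show "A (d + e) \<noteq> {} \<and> real (r d) - 1 + (real (r e) - 1) \<le> real (r (d + e)) - 1"
      using r_pos_iff[of "d + e"] de pos by auto
  next
    fix d :: real assume d: "d > 0" "A d \<noteq> {}"
    then show "0 \<le> real (r d) - 1" using r_pos_iff[of d] by simp
  next
    fix d :: real assume d: "d > 0" "\<not> A d \<noteq> {}"
    then show "real (r d) - 1 \<le> 0" using r_pos_iff[of d] by simp
  next
    fix d :: real assume d: "d > 0"
    show "real (r d) - 1 \<le> C * d"
    proof (cases "A d = {}")
      case True
      then show ?thesis using r_pos_iff[OF d] s_bound[OF d] by simp
    next
      case False
      then show ?thesis using r_le_s[OF d] s_bound[OF d] by linarith
    qed
  next
    show "0 < real (r E) - 1" using r_large[of E] by simp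
  qed (use E ne_large in auto)
  then obtain v where v: "v > 0" "converges_from_below (\<lambda>d. (real (r d) - 1) / d) v" by blast
  have "\<exists>w>0. converges_from_below (\<lambda>d. real (s d) / d) w"
  proof (rule superadditive_converges_from_below[where G = "\<lambda>d. A d \<noteq> {}" and E = E and C = C and D = E])
    fix d e :: real assume de: "d > 0" "e > 0" "A d \<noteq> {}" "A e \<noteq> {}"
    have "order_attained (A (d + e)) (s d + s e)"
      by (rule order_attained_add[OF fin fin fin AA[OF _ _ de(1,2)]])
        (use s_attained de in auto)
    then have "s d + s e \<le> s (d + e)" using de by (intro s_max) auto
    moreover have "A (d + e) \<noteq> {}" using AA[OF _ _ de(1,2)] de(3,4) by blast
    ultimately show "A (d + e) \<noteq> {} \<and> real (s d) + real (s e) \<le> real (s (d + e))" by simp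
  next
    fix d :: real assume d: "d > 0" "\<not> A d \<noteq> {}"
    have "interpolates (A d) 0"
      using d(2) unfolding interpolates_def by (auto intro: exI[of _ "\<lambda>x. 0"])
    then have "s d \<le> 0" unfolding s_eq by (rule Least_le)
    then show "real (s d) \<le> 0" by simp
  next
    show "0 < real (s E)" using r_large[of E] r_le_s[OF E] ne_large[of E] by simp
  qed (use E ne_large s_bound in auto)
  then obtain w where w: "w > 0" "converges_from_below (\<lambda>d. real (s d) / d) w" by blast
  \<comment> \<open>The bound holds for each single large \<open>d\<close>: there
    \<open>r d - 1\<close> is at least 1, as \<open>symbols_volume_inequality\<close> requires, and
    the power of \<open>d\<close> is distributed over the factors. Only afterwards does
    \<open>d\<close> tend to infinity.\<close>
  have le: "((real (r d) - 1) / d) ^ (?n - 1) * (real (s d) / d) \<le> fact ?n * measure lebesgue P"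
    if "d \<ge> E" for d
  proof -
    have d: "d > 0" using that E by simp
    note rd = r_large[OF that] and Ad = ne_large[OF that]
    have "all_monomial_symbols (A d) (r d - 1)" unfolding r_iff[OF d, symmetric] using rd by simp
    then have "real (r d - 1) ^ (?n - 1) * real (s d) \<le> fact ?n * d ^ ?n * measure lebesgue P"
      using s_attained[OF d Ad] rd r_le_s[OF d Ad] unfolding A_def
      by (intro symbols_volume_inequality assms ne d) auto
    moreover have "d ^ ?n = d ^ (?n - 1) * d" by (simp flip: power_Suc2)
    moreover have "real (r d - 1) = real (r d) - 1" using rd by (simp add: of_nat_diff)
    ultimately show ?thesis using d by (simp add: power_divide divide_le_eq mult_ac)
  qed
  have "((\<lambda>d. ((real (r d) - 1) / d) ^ (?n - 1) * (real (s d) / d)) \<longlongrightarrow> v ^ (?n - 1) * w) at_top"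
    using v(2) w(2) unfolding converges_from_below_def by (intro tendsto_intros) auto
  moreover have "\<forall>\<^sub>F d in at_top.
      ((real (r d) - 1) / d) ^ (?n - 1) * (real (s d) / d) \<le> fact ?n * measure lebesgue P"
    using eventually_ge_at_top[of E] by eventually_elim (rule le)
  ultimately have "v ^ (?n - 1) * w \<le> fact ?n * measure lebesgue P"
    by (rule tendsto_upperbound) simp
  with v w show ?thesis unfolding r_def s_def by blast
qed

end
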